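(* Let $G=(V,E)$ be a connected simple undirected graph (not necessarily finite). Then $G$ is isometrically embeddable into a Johnson graph $J(m,\Lambda)$ (for some set $\Lambda$ and some integer $m>0$) if and only if $G$ satisfies the following two conditions: (WC) (Wallspace condition) For every edge $uv$ of $G$, the subgraph of $G$ induced by $W_=(u,v)$ has at most two connected components; and, writing $W'_=(u,v)$ and $W''_=(u,v)$ for (the vertex sets of) these components (one or both of which are allowed to be empty), each of the two pairs $$\mathcal W'_{uv}:=\{\,W(u,v)\cup W'_=(u,v),\; W(v,u)\cup W''_=(u,v)\,\},$$ $$\mathcal W''_{uv}:=\{\,W(u,v)\cup W''_=(u,v),\; W(v,u)\cup W'_=(u,v)\,\}$$ consists of complementary convex subsets (convex halfspaces) of $G$. (AGC) (Atom graph condition) For some basepoint $b\in V$, the atom graph $\Sigma$ of $G$ with respect to $b$ is (isomorphic to) the line-graph of a bipartite graph with at least one part of the bipartition finite. Moreover, the equivalence remains true if in (AGC) "for some basepoint $b$" is replaced by "for any basepoint $b$".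
   Context: All graphs are undirected, connected, without loops or multiple edges, but not necessarily finite (the connectedness convention applies to $G$; auxiliary graphs such as induced subgraphs, the atom graph, and the bipartite graph in (AGC) need not be connected). $d_G(u,v)$ is the length of a shortest $(u,v)$-path in $G$. The interval between $u$ and $v$ is $I(u,v)=\{x\in V: d_G(u,x)+d_G(x,v)=d_G(u,v)\}$. A set $A\subseteq V$ is convex if $I(x,y)\subseteq A$ for all $x,y\in A$. $G=(V,E)$ is isometrically embeddable into a graph $G'=(V',E')$ if there is a map $\varphi:V\to V'$ with $d_{G'}(\varphi(u),\varphi(v))=d_G(u,v)$ for all $u,v\in V$. For a set $\Lambda$ and an integer $m>0$, the Johnson graph $J(m,\Lambda)$ has as vertices the subsets of $\Lambda$ of cardinality $m$, two such sets $A,B$ being adjacent iff $|A\triangle B|=2$. For an edge $uv$ of $G$: $W(u,v)=\{x\in V: d_G(x,u)<d_G(x,v)\}$, $W(v,u)=\{x\in V: d_G(x,v)<d_G(x,u)\}$, and $W_=(u,v)=\{x\in V: d_G(x,u)=d_G(x,v)\}$. If $W_=(u,v)$ induces a connected nonempty subgraph, then one of $W'_=(u,v),W''_=(u,v)$ is $W_=(u,v)$ and the other is empty; if $W_=(u,v)=\emptyset$, both are empty. Atom graph. For two edges $e=uv$, $e'=u'v'$ of $G$ put $\langle e,e'\rangle:=d_G(u,v')+d_G(v,u')-d_G(u,u')-d_G(v,v')\in\{0,\pm1,\pm2\}$ (the sign depends on the ordering of the ends of the edges). Write $e\,\theta_1\,e'$ iff $\langle e,e'\rangle=\pm2$, and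 $e\,\theta_2\,e'$ iff $\langle e,e'\rangle=\pm1$. Fix a vertex $b$ of $G$ (the basepoint). An edge $uv$ is vertical (with respect to $b$) if its ends can be named so that $d_G(b,u)<d_G(b,v)$; $E_0$ is the set of all vertical edges. Whenever $\theta_1$ is an equivalence relation on $E_0$ (which is the case when (WC) holds), the atom graph $\Sigma$ of $G$ with respect to $b$ is defined: its vertices are the equivalence classes of $\theta_1$ on $E_0$, and two classes $E_i,E_j$ are adjacent iff $e\,\theta_2\,e'$ for all $e\in E_i$ and $e'\in E_j$. Condition (AGC) includes the requirement that $\Sigma$ is well-defined. The line-graph $L(D)$ of a graph $D$ has the edges of $D$ as vertices, two distinct edges being adjacent in $L(D)$ iff they share a common end. *)

theory Defs
  imports Main
begin

section \<open>Graphs\<close>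

text \<open>Possibly infinite undirected graphs; an edge is the two-element set of its ends.\<close>

record 'a sgraph =
  vertices :: "'a set"
  edges :: "'a set set"

definition simple_graph :: "'a sgraph \<Rightarrow> bool" where
  "simple_graph G \<longleftrightarrow>
     (\<forall>e\<in>edges G. \<exists>u\<in>vertices G. \<exists>v\<in>vertices G. u \<noteq> v \<and> e = {u, v})"

definition graph_path :: "'a sgraph \<Rightarrow> 'a \<Rightarrow> 'a list \<Rightarrow> 'a \<Rightarrow> bool" where
  "graph_path G u p v \<longleftrightarrow>
     p \<noteq> [] \<and> hd p = u \<and> last p = v \<and> set p \<subseteq> vertices G \<and> distinct p \<and>
     successively (\<lambda>x y. {x, y} \<in> edges G) p"

text \<open>A graph with no vertices does not count as connected: it has no basepoint.\<close>

definition connected_graph :: "'a sgraph \<Rightarrow> bool" where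
  "connected_graph G \<longleftrightarrow>
     vertices G \<noteq> {} \<and> (\<forall>u\<in>vertices G. \<forall>v\<in>vertices G. \<exists>p. graph_path G u p v)"

text \<open>The length of a path is its number of edges. The value is meaningful only if some path
  joins \<open>u\<close> and \<open>v\<close>; below, distances are taken only in connected graphs
  (for Johnson graphs see \<open>johnson_graph_connected\<close>).\<close>

definition gdist :: "'a sgraph \<Rightarrow> 'a \<Rightarrow> 'a \<Rightarrow> nat" where
  "gdist G u v = (LEAST n. \<exists>p. graph_path G u p v \<and> length p = Suc n)"

definition interval :: "'a sgraph \<Rightarrow> 'a \<Rightarrow> 'a \<Rightarrow> 'a set" where
  "interval G u v = {x \<in> vertices G. gdist G u x + gdist G x v = gdist G u v}"

definition geodesically_convex :: "'a sgraph \<Rightarrow> 'a set \<Rightarrow> bool" where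
  "geodesically_convex G A \<longleftrightarrow>
     A \<subseteq> vertices G \<and> (\<forall>x\<in>A. \<forall>y\<in>A. interval G x y \<subseteq> A)"

definition induced_subgraph :: "'a sgraph \<Rightarrow> 'a set \<Rightarrow> 'a sgraph" where
  "induced_subgraph G S = \<lparr>vertices = S, edges = {e \<in> edges G. e \<subseteq> S}\<rparr>"

definition components :: "'a sgraph \<Rightarrow> 'a set set" where
  "components G = {{y \<in> vertices G. \<exists>p. graph_path G x p y} | x. x \<in> vertices G}"

definition graph_isomorphic :: "'a sgraph \<Rightarrow> 'b sgraph \<Rightarrow> bool" where
  "graph_isomorphic G H \<longleftrightarrow>
     (\<exists>f. bij_betw f (vertices G) (vertices H) \<and>
          (\<forall>u\<in>vertices G. \<forall>v\<in>vertices G. {u, v} \<in> edges G \<longleftrightarrow> {f u, f v} \<in> edges H))"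

definition isometrically_embeddable :: "'a sgraph \<Rightarrow> 'b sgraph \<Rightarrow> bool" where
  "isometrically_embeddable G H \<longleftrightarrow>
     (\<exists>f. f ` vertices G \<subseteq> vertices H \<and>
          (\<forall>u\<in>vertices G. \<forall>v\<in>vertices G. gdist H (f u) (f v) = gdist G u v))"

definition line_graph :: "'a sgraph \<Rightarrow> 'a set sgraph" where
  "line_graph D =
     \<lparr>vertices = edges D,
      edges = {{e, f} | e f. e \<in> edges D \<and> f \<in> edges D \<and> e \<noteq> f \<and> e \<inter> f \<noteq> {}}\<rparr>"

definition bipartition :: "'a sgraph \<Rightarrow> 'a set \<Rightarrow> 'a set \<Rightarrow> bool" where
  "bipartition D X Y \<longleftrightarrow>
     X \<union> Y = vertices D \<and> X \<inter> Y = {} \<and> (\<forall>e\<in>edges D. \<exists>x\<in>X. \<exists>y\<in>Y. e = {x, y})"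

section \<open>Johnson graphs\<close>

definition johnson_graph :: "nat \<Rightarrow> 'l set \<Rightarrow> 'l set sgraph" where
  "johnson_graph m \<Lambda> =
     (let S = {A. A \<subseteq> \<Lambda> \<and> finite A \<and> card A = m}
      in \<lparr>vertices = S, edges = {{A, B} | A B. A \<in> S \<and> B \<in> S \<and> card (sym_diff A B) = 2}\<rparr>)"

text \<open>The ground set \<open>\<Lambda>\<close> ranges over the subsets of one fixed type. This loses nothing:
  by \<open>johnson_embeddable_any_type\<close> below, an embedding with a ground set in an arbitrary type
  yields one with a ground set in \<open>'a \<times> nat\<close>.\<close>

definition johnson_embeddable :: "'a sgraph \<Rightarrow> bool" where
  "johnson_embeddable G \<longleftrightarrow>
     (\<exists>m>0. \<exists>\<Lambda>::('a \<times> nat) set. isometrically_embeddable G (johnson_graph m \<Lambda>))"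

section \<open>The wallspace condition\<close>

definition W_less :: "'a sgraph \<Rightarrow> 'a \<Rightarrow> 'a \<Rightarrow> 'a set" where
  "W_less G u v = {x \<in> vertices G. gdist G x u < gdist G x v}"

definition W_eq :: "'a sgraph \<Rightarrow> 'a \<Rightarrow> 'a \<Rightarrow> 'a set" where
  "W_eq G u v = {x \<in> vertices G. gdist G x u = gdist G x v}"

definition complementary_halfspaces :: "'a sgraph \<Rightarrow> 'a set \<Rightarrow> 'a set \<Rightarrow> bool" where
  "complementary_halfspaces G A B \<longleftrightarrow>
     A \<union> B = vertices G \<and> A \<inter> B = {} \<and> geodesically_convex G A \<and> geodesically_convex G B"

text \<open>Components are nonempty, so the condition on \<open>W'\<close> and \<open>W''\<close> says that they are the two
  components, or the only component and the empty set, or both empty; disjointness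
  excludes \<open>W' = W''\<close> in the case of a single component.\<close>

definition wallspace_condition :: "'a sgraph \<Rightarrow> bool" where
  "wallspace_condition G \<longleftrightarrow>
     (\<forall>u v. {u, v} \<in> edges G \<longrightarrow>
        (let C = components (induced_subgraph G (W_eq G u v))
         in finite C \<and> card C \<le> 2 \<and>
            (\<forall>W' W''. W' \<inter> W'' = {} \<and> {W', W''} - {{}} = C \<longrightarrow>
               complementary_halfspaces G (W_less G u v \<union> W') (W_less G v u \<union> W'') \<and>
               complementary_halfspaces G (W_less G u v \<union> W'') (W_less G v u \<union> W'))))"

section \<open>The atom graph condition\<close>

definition edge_bracket :: "'a sgraph \<Rightarrow> 'a \<Rightarrow> 'a \<Rightarrow> 'a \<Rightarrow> 'a \<Rightarrow> int" where
  "edge_bracket G u v u' v' =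
     int (gdist G u v') + int (gdist G v u') - int (gdist G u u') - int (gdist G v v')"

text \<open>Interchanging the ends of an edge only changes the sign of the bracket, so in the next two
  definitions it does not matter which naming of the ends is chosen.\<close>

definition theta1 :: "'a sgraph \<Rightarrow> 'a set \<Rightarrow> 'a set \<Rightarrow> bool" where
  "theta1 G e e' \<longleftrightarrow>
     (\<exists>u v u' v'. e = {u, v} \<and> e' = {u', v'} \<and> \<bar>edge_bracket G u v u' v'\<bar> = 2)"

definition theta2 :: "'a sgraph \<Rightarrow> 'a set \<Rightarrow> 'a set \<Rightarrow> bool" where
  "theta2 G e e' \<longleftrightarrow>
     (\<exists>u v u' v'. e = {u, v} \<and> e' = {u', v'} \<and> \<bar>edge_bracket G u v u' v'\<bar> = 1)"

definition vertical_edges :: "'a sgraph \<Rightarrow> 'a \<Rightarrow> 'a set set" where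
  "vertical_edges G b = {e \<in> edges G. \<exists>u v. e = {u, v} \<and> gdist G b u < gdist G b v}"

definition theta1_vertical :: "'a sgraph \<Rightarrow> 'a \<Rightarrow> ('a set \<times> 'a set) set" where
  "theta1_vertical G b =
     {(e, e'). e \<in> vertical_edges G b \<and> e' \<in> vertical_edges G b \<and> theta1 G e e'}"

definition atom_graph_well_defined :: "'a sgraph \<Rightarrow> 'a \<Rightarrow> bool" where
  "atom_graph_well_defined G b \<longleftrightarrow> equiv (vertical_edges G b) (theta1_vertical G b)"

definition atom_graph :: "'a sgraph \<Rightarrow> 'a \<Rightarrow> 'a set set sgraph" where
  "atom_graph G b =
     (let Q = vertical_edges G b // theta1_vertical G b
      in \<lparr>vertices = Q,
          edges = {{P, R} | P R. P \<in> Q \<and> R \<in> Q \<and> P \<noteq> R \<and> (\<forall>e\<in>P. \<forall>e'\<in>R. theta2 G e e')}\<rparr>)"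

text \<open>As with \<open>johnson_embeddable\<close>, the vertex type of \<open>D\<close> is fixed but large enough:
  see \<open>semifinite_bipartite_line_graph_any_type\<close> below.\<close>

definition semifinite_bipartite_line_graph :: "'v sgraph \<Rightarrow> bool" where
  "semifinite_bipartite_line_graph H \<longleftrightarrow>
     (\<exists>(D :: ('v \<times> bool) sgraph) X Y.
        simple_graph D \<and> bipartition D X Y \<and> (finite X \<or> finite Y) \<and>
        graph_isomorphic H (line_graph D))"

definition atom_graph_condition :: "'a sgraph \<Rightarrow> 'a \<Rightarrow> bool" where
  "atom_graph_condition G b \<longleftrightarrow>
     atom_graph_well_defined G b \<and> semifinite_bipartite_line_graph (atom_graph G b)"

section \<open>Distances in Johnson graphs\<close>

lemma johnson_vertices:
  "A \<in> vertices (johnson_graph m \<Lambda>) \<longleftrightarrow> A \<subseteq> \<Lambda> \<and> finite A \<and> card A = m"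
  by (simp add: johnson_graph_def Let_def)

lemma johnson_edges:
  "{A, B} \<in> edges (johnson_graph m \<Lambda>) \<longleftrightarrow>
     A \<in> vertices (johnson_graph m \<Lambda>) \<and> B \<in> vertices (johnson_graph m \<Lambda>) \<and>
     card (sym_diff A B) = 2"
  by (auto simp: johnson_graph_def Let_def doubleton_eq_iff Un_commute)

lemma card_sym_diff_eq:
  assumes "finite A" "finite B" "card A = card B"
  shows "card (sym_diff A B) = 2 * card (A - B)"
proof -
  have "card (A - B) = card (B - A)"
    using assms by (simp add: card_Diff_subset_Int Int_commute)
  moreover have "card (sym_diff A B) = card (A - B) + card (B - A)"
    using assms by (intro card_Un_disjoint) auto
  ultimately show ?thesis by simp
qed

lemma johnson_edge_iff:
  assumes "A \<in> vertices (johnson_graph m \<Lambda>)" "B \<in> vertices (johnson_graph m \<Lambda>)"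
  shows "{A, B} \<in> edges (johnson_graph m \<Lambda>) \<longleftrightarrow> card (A - B) = 1"
  using assms card_sym_diff_eq[of A B] by (auto simp: johnson_edges johnson_vertices)

lemma johnson_path_length:
  assumes "graph_path (johnson_graph m \<Lambda>) A p B"
  shows "card (A - B) < length p"
  using assms
proof (induction p arbitrary: A)
  case Nil
  then show ?case by (simp add: graph_path_def)
next
  case (Cons A' p)
  have [simp]: "A' = A" using Cons.prems by (simp add: graph_path_def)
  show ?case
  proof (cases p)
    case Nil
    then show ?thesis using Cons.prems by (simp add: graph_path_def)
  next
    case (Cons C q)
    have pth: "graph_path (johnson_graph m \<Lambda>) C p B" and e: "{A, C} \<in> edges (johnson_graph m \<Lambda>)"
      using Cons.prems Cons by (auto simp: graph_path_def)
    have fin: "finite A" "finite C" and AC: "card (A - C) = 1"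
      using e johnson_edge_iff[of A m \<Lambda> C] by (auto simp: johnson_edges johnson_vertices)
    have "card (A - B) \<le> card ((A - C) \<union> (C - B))"
      using fin by (intro card_mono) auto
    also have "\<dots> \<le> card (A - C) + card (C - B)" by (rule card_Un_le)
    also have "\<dots> < 1 + length p" using Cons.IH[OF pth] AC by simp
    finally show ?thesis by simp
  qed
qed

lemma johnson_path_exists:
  assumes "A \<in> vertices (johnson_graph m \<Lambda>)" "B \<in> vertices (johnson_graph m \<Lambda>)"
  shows "\<exists>p. graph_path (johnson_graph m \<Lambda>) A p B \<and> length p = Suc (card (A - B)) \<and>
             (\<forall>X\<in>set p. card (X - B) \<le> card (A - B))"
  using assms(1)
proof (induction "card (A - B)" arbitrary: A)
  case 0
  then have "A - B = {}" by (simp add: johnson_vertices)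
  then have "A = B"
    using 0 assms(2) by (intro card_subset_eq) (auto simp: johnson_vertices)
  then show ?case
    using 0 by (intro exI[of _ "[A]"]) (auto simp: graph_path_def)
next
  case (Suc n)
  have A: "A \<subseteq> \<Lambda>" "finite A" "card A = m" and B: "B \<subseteq> \<Lambda>" "finite B" "card B = m"
    using Suc.prems assms(2) by (auto simp: johnson_vertices)
  have cards: "card (A - B) = card (B - A)"
    using A B by (simp add: card_Diff_subset_Int Int_commute)
  obtain a where a: "a \<in> A" "a \<notin> B"
    using Suc.hyps(2) by (metis Diff_iff card.empty equals0I nat.simps(3))
  obtain c where c: "c \<in> B" "c \<notin> A"
    using Suc.hyps(2) cards by (metis Diff_iff card.empty equals0I nat.simps(3))
  define C where "C = insert c (A - {a})"
  have "card C = m"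
    using A a c card_Suc_Diff1[of A a] by (simp add: C_def del: card_Diff_insert)
  then have C: "C \<in> vertices (johnson_graph m \<Lambda>)"
    using A B c by (auto simp: johnson_vertices C_def)
  have "C - B = (A - B) - {a}" using c by (auto simp: C_def)
  then have CB: "card (C - B) = n" using Suc.hyps(2) a A by simp
  have "A - C = {a}" using a c by (auto simp: C_def)
  then have e: "{A, C} \<in> edges (johnson_graph m \<Lambda>)"
    using johnson_edge_iff[OF Suc.prems C] by simp
  obtain p where p: "graph_path (johnson_graph m \<Lambda>) C p B" "length p = Suc n"
    "\<forall>X\<in>set p. card (X - B) \<le> n"
    using Suc.hyps(1)[of C] CB C by auto
  have "A \<notin> set p" using p(3) Suc.hyps(2) by auto
  then have "graph_path (johnson_graph m \<Lambda>) A (A # p) B"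
    using p(1) e Suc.prems by (cases p) (auto simp: graph_path_def)
  then show ?case
    using p Suc.hyps(2) by (intro exI[of _ "A # p"]) (auto intro: le_SucI)
qed

lemma johnson_graph_connected:
  assumes "vertices (johnson_graph m \<Lambda>) \<noteq> {}"
  shows "connected_graph (johnson_graph m \<Lambda>)"
  using assms johnson_path_exists unfolding connected_graph_def by blast

lemma gdist_johnson:
  assumes "A \<in> vertices (johnson_graph m \<Lambda>)" "B \<in> vertices (johnson_graph m \<Lambda>)"
  shows "gdist (johnson_graph m \<Lambda>) A B = card (A - B)"
  unfolding gdist_def
proof (rule Least_equality)
  show "\<exists>p. graph_path (johnson_graph m \<Lambda>) A p B \<and> length p = Suc (card (A - B))"
    using johnson_path_exists[OF assms] by blast
next
  fix n assume "\<exists>p. graph_path (johnson_graph m \<Lambda>) A p B \<and> length p = Suc n"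
  then show "card (A - B) \<le> n" using johnson_path_length by fastforce
qed

section \<open>Independence of the choice of types\<close>

theorem johnson_embeddable_any_type:
  fixes G :: "'a sgraph" and \<Lambda> :: "'l set"
  assumes "m > 0" and "isometrically_embeddable G (johnson_graph m \<Lambda>)"
  shows "johnson_embeddable G"
proof -
  obtain f where f: "f ` vertices G \<subseteq> vertices (johnson_graph m \<Lambda>)"
    and dist: "\<And>u v. u \<in> vertices G \<Longrightarrow> v \<in> vertices G \<Longrightarrow>
                 gdist (johnson_graph m \<Lambda>) (f u) (f v) = gdist G u v"
    using assms(2) unfolding isometrically_embeddable_def by (elim exE conjE) simp
  have fv: "f v \<in> vertices (johnson_graph m \<Lambda>)" if "v \<in> vertices G" for v using f that by auto
  have fin: "finite (f v)" "card (f v) = m" if "v \<in> vertices G" for v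
    using fv[OF that] by (auto simp: johnson_vertices)
  define U where "U = \<Union> (f ` vertices G)"
  have "\<forall>x. \<exists>v. x \<in> U \<longrightarrow> v \<in> vertices G \<and> x \<in> f v" by (auto simp: U_def)
  then obtain s where s: "\<And>x. x \<in> U \<Longrightarrow> s x \<in> vertices G \<and> x \<in> f (s x)" by metis
  define h :: "'a \<Rightarrow> 'l \<Rightarrow> nat" where "h = (\<lambda>v. SOME k. inj_on k (f v))"
  have h: "inj_on (h v) (f v)" if "v \<in> vertices G" for v
  proof -
    have "\<exists>k::'l \<Rightarrow> nat. inj_on k (f v)"
      using finite_imp_inj_to_nat_seg[OF fin(1)[OF that]] by blast
    then show ?thesis unfolding h_def by (rule someI_ex)
  qed
  define g where "g = (\<lambda>x. (s x, h (s x) x))"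
  have g: "inj_on g U"
  proof (rule inj_onI)
    fix x y assume "x \<in> U" "y \<in> U" "g x = g y"
    then show "x = y" using s[of x] s[of y] h[of "s x"] by (auto simp: g_def dest: inj_onD)
  qed
  have sub: "f v \<subseteq> U" if "v \<in> vertices G" for v using that by (auto simp: U_def)
  have gv: "g ` f v \<in> vertices (johnson_graph m (g ` U))" if "v \<in> vertices G" for v
    using sub[OF that] fin[OF that] card_image[OF inj_on_subset[OF g sub[OF that]]]
    by (simp add: johnson_vertices image_mono)
  have "gdist (johnson_graph m (g ` U)) (g ` f u) (g ` f v) = gdist G u v"
    if uv: "u \<in> vertices G" "v \<in> vertices G" for u v
  proof -
    have "g ` f u - g ` f v = g ` (f u - f v)"
      using inj_on_image_set_diff[OF g, of "f u" "f v"] sub uv by blast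
    moreover have "inj_on g (f u - f v)"
      using sub[OF uv(1)] by (intro inj_on_subset[OF g]) blast
    ultimately have "card (g ` f u - g ` f v) = card (f u - f v)"
      by (simp add: card_image)
    then show ?thesis
      using dist[OF uv] gdist_johnson[OF gv[OF uv(1)] gv[OF uv(2)]]
        gdist_johnson[OF fv[OF uv(1)] fv[OF uv(2)]] by simp
  qed
  then have "isometrically_embeddable G (johnson_graph m (g ` U))"
    unfolding isometrically_embeddable_def using gv by (intro exI[of _ "\<lambda>v. g ` f v"]) auto
  then show ?thesis
    using assms(1) unfolding johnson_embeddable_def by blast
qed

lemma line_graph_edges:
  "{e, e'} \<in> edges (line_graph K) \<longleftrightarrow>
     e \<in> edges K \<and> e' \<in> edges K \<and> e \<noteq> e' \<and> e \<inter> e' \<noteq> {}"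
  by (auto simp: line_graph_def doubleton_eq_iff Int_commute)

theorem semifinite_bipartite_line_graph_any_type:
  fixes H :: "'v sgraph" and D :: "'d sgraph"
  assumes bip: "bipartition D X Y" and fin: "finite X \<or> finite Y"
    and iso: "graph_isomorphic H (line_graph D)"
  shows "semifinite_bipartite_line_graph H"
proof -
  obtain f where f: "bij_betw f (vertices H) (edges D)"
    and adj: "\<And>u v. u \<in> vertices H \<Longrightarrow> v \<in> vertices H \<Longrightarrow>
                {u, v} \<in> edges H \<longleftrightarrow> {f u, f v} \<in> edges (line_graph D)"
    using iso unfolding graph_isomorphic_def by (auto simp: line_graph_def)
  have disj: "X \<inter> Y = {}" and ends: "\<And>e. e \<in> edges D \<Longrightarrow> \<exists>x\<in>X. \<exists>y\<in>Y. e = {x, y}"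
    using bip by (auto simp: bipartition_def)
  define N where "N = \<Union> (edges D)"
  have NXY: "N \<subseteq> X \<union> Y" using ends by (fastforce simp: N_def)
  have "\<forall>x. \<exists>w. x \<in> N \<longrightarrow> w \<in> vertices H \<and> x \<in> f w"
    using f by (auto simp: N_def bij_betw_def)
  then obtain s where s: "\<And>x. x \<in> N \<Longrightarrow> s x \<in> vertices H \<and> x \<in> f (s x)" by metis
  define g where "g = (\<lambda>x. (s x, x \<in> X))"
  have g: "inj_on g N"
  proof (rule inj_onI)
    fix x y assume xy: "x \<in> N" "y \<in> N" "g x = g y"
    then have eq: "s x = s y" "x \<in> X \<longleftrightarrow> y \<in> X" by (auto simp: g_def)
    have "f (s x) \<in> edges D" using s[OF xy(1)] f by (auto simp: bij_betw_def)
    then obtain a c where "a \<in> X" "c \<in> Y" "f (s x) = {a, c}" using ends by blast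
    then show "x = y" using s[OF xy(1)] s[OF xy(2)] eq disj by auto
  qed
  have sub: "e \<subseteq> N" if "e \<in> edges D" for e using that by (auto simp: N_def)
  define D' where "D' = \<lparr>vertices = g ` N, edges = (`) g ` edges D\<rparr>"
  have ends': "\<exists>x\<in>X \<inter> N. \<exists>y\<in>Y \<inter> N. e = {x, y}" if "e \<in> edges D" for e
    using ends[OF that] sub[OF that] by auto
  have part: "g ` (X \<inter> N) \<inter> g ` (Y \<inter> N) = {}"
    using disj by (auto simp: g_def)
  have un: "g ` (X \<inter> N) \<union> g ` (Y \<inter> N) = g ` N"
    using NXY by blast
  have bip': "bipartition D' (g ` (X \<inter> N)) (g ` (Y \<inter> N))"
    unfolding bipartition_def
  proof (intro conjI ballI)
    fix e assume "e \<in> edges D'"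
    then obtain e0 where "e0 \<in> edges D" "e = g ` e0" by (auto simp: D'_def)
    then show "\<exists>x\<in>g ` (X \<inter> N). \<exists>y\<in>g ` (Y \<inter> N). e = {x, y}"
      using ends'[of e0] by auto
  qed (use part un in \<open>simp_all add: D'_def\<close>)
  have simp': "simple_graph D'"
    unfolding simple_graph_def
  proof
    fix e assume "e \<in> edges D'"
    then have "\<exists>x\<in>g ` (X \<inter> N). \<exists>y\<in>g ` (Y \<inter> N). e = {x, y}"
      using bip' by (simp only: bipartition_def)
    then obtain x y where xy: "x \<in> g ` (X \<inter> N)" "y \<in> g ` (Y \<inter> N)" "e = {x, y}"
      by (elim bexE)
    have "x \<noteq> y" using xy part by (metis IntI empty_iff)
    moreover have "x \<in> vertices D'" "y \<in> vertices D'"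
      using xy(1,2) by (auto simp: D'_def)
    ultimately show "\<exists>u\<in>vertices D'. \<exists>v\<in>vertices D'. u \<noteq> v \<and> e = {u, v}"
      using xy(3) by blast
  qed
  have fin': "finite (g ` (X \<inter> N)) \<or> finite (g ` (Y \<inter> N))" using fin by auto
  have gE: "inj_on ((`) g) (edges D)"
    using inj_on_image_eq_iff[OF g] sub by (intro inj_onI) blast
  have bij: "bij_betw (\<lambda>w. g ` f w) (vertices H) (edges D')"
    using bij_betw_trans[OF f, of "(`) g"] gE by (auto simp: bij_betw_def D'_def comp_def)
  have "{u, v} \<in> edges H \<longleftrightarrow> {g ` f u, g ` f v} \<in> edges (line_graph D')"
    if uv: "u \<in> vertices H" "v \<in> vertices H" for u v
  proof -
    have E: "f u \<in> edges D" "f v \<in> edges D" using uv f by (auto simp: bij_betw_def)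
    have "g ` f u \<inter> g ` f v = g ` (f u \<inter> f v)"
      using inj_on_image_Int[OF g, of "f u" "f v"] sub E by blast
    moreover have "g ` f u = g ` f v \<longleftrightarrow> f u = f v"
      using gE E by (auto dest: inj_onD)
    moreover have "g ` f u \<in> edges D'" "g ` f v \<in> edges D'"
      using E by (auto simp: D'_def)
    ultimately show ?thesis
      using adj[OF uv] E by (simp add: line_graph_edges)
  qed
  then have "graph_isomorphic H (line_graph D')"
    using bij unfolding graph_isomorphic_def
    by (intro exI[of _ "\<lambda>w. g ` f w"]) (auto simp: line_graph_def)
  then show ?thesis
    unfolding semifinite_bipartite_line_graph_def using simp' bip' fin' by blast
qed

end

theory Submission
  imports Defs
begin

text \<open>
  The proof passes through one intermediate object. Call an edge \<open>uv\<close> with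
  \<open>d b v = d b u + 1\<close> an upward edge. A labelling assigns to every upward edge a pair
  \<open>{x, y}\<close> with \<open>x \<in> X\<close> and \<open>y \<notin> X\<close>, in such a way that the
  bracket of two upward edges is the number of elements that their labels share. Given the wallspace
  condition, the existence of a labelling with \<open>X\<close> finite is equivalent both to the
  atom graph condition at \<open>b\<close> and to embeddability. As \<open>b\<close> is
  arbitrary throughout, the choice of basepoint does not matter.

  \<^item> In an isometric embedding \<open>f\<close> into a Johnson graph, crossing an edge
  replaces one element \<open>i\<close> by another, \<open>j\<close>, and
  \<open>d x u - d x v = [j \<in> f x] - [i \<in> f x]\<close>. The sets
  \<open>{x. i \<in> f x}\<close> and \<open>{x. j \<in> f x}\<close> and their complements are
  convex, and the parts of \<open>W_eq\<close> on which \<open>i\<close> and \<open>j\<close> are both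
  present or both absent are its components, which gives the wallspace condition
  (\<open>embedded_WC\<close>). The pairs \<open>{i, j}\<close> label the upward edges, with \<open>X = f b\<close> (\<open>embedded_labelling\<close>).

  \<^item> A labelling with \<open>X\<close> finite makes the set of labels a bipartite graph whose
  line graph is the atom graph (\<open>labelling_imp_AGC\<close>). Conversely, a bipartite
  graph \<open>D\<close> whose line graph is the atom graph labels each upward edge by the edge of
  \<open>D\<close> that corresponds to its class (\<open>AGC_imp_labelling\<close>). Here the
  wallspace condition is what excludes negative brackets: the line graph records only their
  absolute values.

  \<^item> A labelling yields an embedding (\<open>labelling_imp_embeddable\<close>). Let
  \<open>S v\<close> be the union of the labels along one geodesic from \<open>b\<close> to
  \<open>v\<close>. Brackets telescope along the geodesic to the difference of two values in
  \<open>{-1, 0, 1}\<close>, hence their sum is at most 2; each label already contributes 2 to the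
  sum for its own edge, so the labels on a geodesic are disjoint. The same telescoping gives
  \<open>d u v = d b u + d b v - card (S u \<inter> S v)\<close>, and this is the distance in
  the Johnson graph between the symmetric differences of \<open>X\<close> with \<open>S u\<close>
  and with \<open>S v\<close>.
\<close>

section \<open>Walks and distances\<close>

definition adj :: "'a sgraph \<Rightarrow> ('a \<times> 'a) set" where
  "adj G = {(x, y). {x, y} \<in> edges G}"

lemma simple_graph_edgeD:
  assumes "simple_graph G" "{x, y} \<in> edges G"
  shows "x \<in> vertices G" "y \<in> vertices G" "x \<noteq> y"
  using assms by (fastforce simp: simple_graph_def doubleton_eq_iff)+

lemma adj_sym: "(x, y) \<in> adj G \<Longrightarrow> (y, x) \<in> adj G"
  by (simp add: adj_def insert_commute)

lemma walk_sym: "(x, y) \<in> adj G ^^ n \<Longrightarrow> (y, x) \<in> adj G ^^ n"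
proof (induction n arbitrary: y)
  case (Suc n)
  then show ?case by (meson adj_sym relpow_Suc_E relpow_Suc_I2)
qed simp

lemma reach_sym: "(x, y) \<in> (adj G)\<^sup>* \<Longrightarrow> (y, x) \<in> (adj G)\<^sup>*"
  by (meson walk_sym rtrancl_power)

lemma graph_path_imp_walk:
  "graph_path G u p v \<Longrightarrow> (u, v) \<in> adj G ^^ (length p - 1)"
proof (induction p arbitrary: u)
  case (Cons a p)
  show ?case
  proof (cases p)
    case (Cons c q)
    then have "graph_path G c p v" "(u, c) \<in> adj G"
      using Cons.prems by (auto simp: graph_path_def adj_def)
    then have "(u, v) \<in> adj G ^^ Suc (length p - 1)"
      using Cons.IH[of c] by (blast intro: relpow_Suc_I2)
    then show ?thesis using Cons by simp
  qed (use Cons.prems in \<open>auto simp: graph_path_def\<close>)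
qed (simp add: graph_path_def)

text \<open>Paths have no repeated vertices. Prepending a vertex that the path already visits
  is avoided by cutting the path at that vertex, which only shortens it.\<close>

lemma walk_imp_graph_path:
  assumes "simple_graph G" "u \<in> vertices G" "(u, v) \<in> adj G ^^ n"
  shows "\<exists>p. graph_path G u p v \<and> length p \<le> Suc n"
  using assms(2,3)
proof (induction n arbitrary: u)
  case 0
  then show ?case by (intro exI[of _ "[u]"]) (simp add: graph_path_def)
next
  case (Suc n)
  obtain x where x: "(u, x) \<in> adj G" "(x, v) \<in> adj G ^^ n"
    using relpow_Suc_D2[OF Suc.prems(2)] by blast
  have "x \<in> vertices G"
    using x(1) simple_graph_edgeD[OF assms(1)] by (auto simp: adj_def)
  then obtain p where p: "graph_path G x p v" "length p \<le> Suc n"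
    using Suc.IH x(2) by blast
  show ?case
  proof (cases "u \<in> set p")
    case True
    then obtain xs ys where s: "p = xs @ u # ys" by (meson split_list)
    then have "graph_path G u (u # ys) v"
      using p(1) by (auto simp: graph_path_def successively_append_iff)
    then show ?thesis using p(2) s by (intro exI[of _ "u # ys"]) auto
  next
    case False
    then have "graph_path G u (u # p) v"
      using p(1) x(1) Suc.prems(1) by (cases p) (auto simp: graph_path_def adj_def)
    then show ?thesis using p(2) by (intro exI[of _ "u # p"]) auto
  qed
qed

lemma graph_path_iff_reach:
  assumes "simple_graph G" "u \<in> vertices G"
  shows "(\<exists>p. graph_path G u p v) \<longleftrightarrow> (u, v) \<in> (adj G)\<^sup>*"
  using walk_imp_graph_path[OF assms] graph_path_imp_walk by (metis rtrancl_power)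

lemma simple_induced_subgraph:
  "simple_graph G \<Longrightarrow> simple_graph (induced_subgraph G S)"
  by (fastforce simp: simple_graph_def induced_subgraph_def)

lemma reach_in_vertices:
  assumes "simple_graph G" "(x, y) \<in> (adj G)\<^sup>*" "x \<in> vertices G"
  shows "y \<in> vertices G"
  using assms(2,3)
  by (induction rule: rtrancl_induct) (auto simp: adj_def dest: simple_graph_edgeD[OF assms(1)])

lemma components_eq_reach:
  assumes "simple_graph G"
  shows "components G = {{y. (x, y) \<in> (adj G)\<^sup>*} | x. x \<in> vertices G}"
proof -
  have "{y \<in> vertices G. \<exists>p. graph_path G x p y} = {y. (x, y) \<in> (adj G)\<^sup>*}"
    if "x \<in> vertices G" for x
    using graph_path_iff_reach[OF assms that] reach_in_vertices[OF assms _ that] by auto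
  then show ?thesis unfolding components_def by blast
qed

lemma Union_components:
  assumes "simple_graph G"
  shows "\<Union> (components G) = vertices G"
proof
  show "\<Union> (components G) \<subseteq> vertices G" by (auto simp: components_def)
  show "vertices G \<subseteq> \<Union> (components G)"
    unfolding components_eq_reach[OF assms] by blast
qed

lemma components_nonempty: "simple_graph G \<Longrightarrow> {} \<notin> components G"
  unfolding components_eq_reach by blast

lemma components_disjoint:
  assumes "simple_graph G" "A \<in> components G" "B \<in> components G" "A \<noteq> B"
  shows "A \<inter> B = {}"
proof (rule ccontr)
  assume "A \<inter> B \<noteq> {}"
  then obtain x y z where A: "A = {w. (x, w) \<in> (adj G)\<^sup>*}" and B: "B = {w. (y, w) \<in> (adj G)\<^sup>*}"
    and z: "(x, z) \<in> (adj G)\<^sup>*" "(y, z) \<in> (adj G)\<^sup>*"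
    using assms by (auto simp: components_eq_reach)
  have xy: "(x, y) \<in> (adj G)\<^sup>*" using z(1) reach_sym[OF z(2)] by (rule rtrancl_trans)
  have "A = B"
    unfolding A B using rtrancl_trans[OF xy] rtrancl_trans[OF reach_sym[OF xy]] by blast
  then show False using assms by simp
qed

text \<open>Either piece may be empty, as in the wallspace condition.\<close>

lemma components_two_pieces:
  assumes H: "simple_graph H" and AB: "vertices H = A \<union> B" "A \<inter> B = {}"
    and sep: "\<And>x y. x \<in> A \<Longrightarrow> y \<in> B \<Longrightarrow> {x, y} \<notin> edges H"
    and conA: "\<And>x y. x \<in> A \<Longrightarrow> y \<in> A \<Longrightarrow> (x, y) \<in> (adj H)\<^sup>*"
    and conB: "\<And>x y. x \<in> B \<Longrightarrow> y \<in> B \<Longrightarrow> (x, y) \<in> (adj H)\<^sup>*"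
  shows "components H = {A, B} - {{}}"
proof -
  have closed: "y \<in> A \<longleftrightarrow> x \<in> A" if "(x, y) \<in> (adj H)\<^sup>*" for x y
    using that
  proof (induction rule: rtrancl_induct)
    case (step y z)
    then have e: "{y, z} \<in> edges H" by (simp add: adj_def)
    then have "y \<in> A \<union> B" "z \<in> A \<union> B" using simple_graph_edgeD[OF H e] AB by auto
    then have "y \<in> A \<longleftrightarrow> z \<in> A" using sep[of y z] sep[of z y] e AB(2) by (auto simp: insert_commute)
    then show ?case using step by simp
  qed simp
  have cA: "{y. (x, y) \<in> (adj H)\<^sup>*} = A" if "x \<in> A" for x
    using conA that closed by blast
  have cB: "{y. (x, y) \<in> (adj H)\<^sup>*} = B" if "x \<in> B" for x
  proof -
    have "x \<notin> A" using that AB by auto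
    then show ?thesis
      using conB[OF that] closed reach_in_vertices[OF H] that AB by blast
  qed
  have "components H = {{y. (x, y) \<in> (adj H)\<^sup>*} | x. x \<in> A} \<union> {{y. (x, y) \<in> (adj H)\<^sup>*} | x. x \<in> B}"
    using AB(1) by (auto simp: components_eq_reach[OF H])
  also have "\<dots> = (\<lambda>_. A) ` A \<union> (\<lambda>_. B) ` B"
    unfolding Setcompr_eq_image using cA cB by (intro arg_cong2[where f = "(\<union>)"] image_cong) auto
  also have "\<dots> = {A, B} - {{}}" by auto
  finally show ?thesis .
qed

locale metric_graph =
  fixes G :: "'a sgraph"
  assumes simple: "simple_graph G" and connected: "connected_graph G"
begin

abbreviation V where "V \<equiv> vertices G"
abbreviation E where "E \<equiv> edges G"
abbreviation d where "d \<equiv> gdist G"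

lemmas edgeD = simple_graph_edgeD[OF simple]

lemma gdist_le_walk:
  assumes "u \<in> V" "(u, v) \<in> adj G ^^ n"
  shows "d u v \<le> n"
proof -
  obtain p where p: "graph_path G u p v" "length p \<le> Suc n"
    using walk_imp_graph_path[OF simple assms] by blast
  then have "length p = Suc (length p - 1)" by (cases p) (auto simp: graph_path_def)
  then have "d u v \<le> length p - 1" unfolding gdist_def using p(1) by (intro Least_le) blast
  then show ?thesis using p(2) by simp
qed

lemma gdist_walk:
  assumes "u \<in> V" "v \<in> V"
  shows "(u, v) \<in> adj G ^^ d u v"
proof -
  obtain p where p: "graph_path G u p v"
    using connected assms by (auto simp: connected_graph_def)
  then have "length p = Suc (length p - 1)" by (cases p) (auto simp: graph_path_def)
  then have "\<exists>n p. graph_path G u p v \<and> length p = Suc n" using p by blast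
  then have "\<exists>p. graph_path G u p v \<and> length p = Suc (d u v)"
    unfolding gdist_def by (rule LeastI_ex)
  then show ?thesis using graph_path_imp_walk by fastforce
qed

lemma d_self [simp]: "u \<in> V \<Longrightarrow> d u u = 0"
  using gdist_le_walk[of u u 0] by simp

lemma d_eq_0: "u \<in> V \<Longrightarrow> v \<in> V \<Longrightarrow> d u v = 0 \<longleftrightarrow> u = v"
  using gdist_walk[of u v] by auto

lemma d_sym: "u \<in> V \<Longrightarrow> v \<in> V \<Longrightarrow> d u v = d v u"
  by (meson gdist_le_walk gdist_walk walk_sym le_antisym)

lemma d_triangle: "u \<in> V \<Longrightarrow> v \<in> V \<Longrightarrow> w \<in> V \<Longrightarrow> d u w \<le> d u v + d v w"
  by (meson gdist_le_walk gdist_walk relpow_trans)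

lemma d_edge:
  assumes "{u, v} \<in> E"
  shows "d u v = 1"
proof -
  have "d u v \<le> 1"
    using gdist_le_walk[of u v 1] assms edgeD[OF assms] by (simp add: adj_def)
  then show ?thesis using d_eq_0[of u v] edgeD[OF assms] by linarith
qed

lemma d_Suc_predecessor:
  assumes "u \<in> V" "v \<in> V" "d u v = Suc n"
  obtains w where "w \<in> V" "{w, v} \<in> E" "d u w = n"
proof -
  obtain w where w: "(u, w) \<in> adj G ^^ n" "{w, v} \<in> E"
    using gdist_walk[OF assms(1,2)] assms(3) by (auto simp: adj_def)
  have wV: "w \<in> V" using edgeD[OF w(2)] by simp
  have "d u w \<le> n" using gdist_le_walk[OF assms(1) w(1)] .
  moreover have "Suc n \<le> d u w + 1"
    using d_triangle[OF assms(1) wV assms(2)] d_edge[OF w(2)] assms(3) by simp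
  ultimately show thesis using that wV w(2) by simp
qed

definition up :: "'a \<Rightarrow> 'a \<Rightarrow> 'a \<Rightarrow> bool" where
  "up b u v \<longleftrightarrow> {u, v} \<in> E \<and> d b v = Suc (d b u)"

lemma upD:
  assumes "up b u v"
  shows "{u, v} \<in> E" "u \<in> V" "v \<in> V" "d b v = Suc (d b u)"
  using assms edgeD by (auto simp: up_def)

lemma edge_d_le:
  assumes "b \<in> V" "{u, v} \<in> E"
  shows "d b v \<le> Suc (d b u)"
  using d_triangle[OF assms(1) edgeD(1,2)[OF assms(2)]] d_edge[OF assms(2)] by simp

lemma geodesic_exists:
  assumes "b \<in> V" "v \<in> V"
  shows "\<exists>w. w 0 = b \<and> w (d b v) = v \<and> (\<forall>k<d b v. up b (w k) (w (Suc k)))"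
  using assms(2)
proof (induction "d b v" arbitrary: v)
  case 0
  then have "b = v" using d_eq_0[OF assms(1)] by simp
  then show ?case using 0 by (intro exI[of _ "\<lambda>_. b"]) simp
next
  case (Suc n)
  obtain x where x: "x \<in> V" "{x, v} \<in> E" "d b x = n"
    using d_Suc_predecessor[OF assms(1) Suc.prems Suc.hyps(2)[symmetric]] .
  obtain w where w: "w 0 = b" "w n = x" "\<forall>k<n. up b (w k) (w (Suc k))"
    using Suc.hyps(1)[of x] x by auto
  have n: "d b v = Suc n" using Suc.hyps(2) by simp
  have "up b (w n) v" using x w n by (simp add: up_def)
  then show ?case
    using w unfolding n by (intro exI[of _ "w(Suc n := v)"]) (auto simp: less_Suc_eq)
qed

lemma vertical_iff_up:
  assumes "b \<in> V"
  shows "e \<in> vertical_edges G b \<longleftrightarrow> (\<exists>u v. e = {u, v} \<and> up b u v)"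
proof
  assume "e \<in> vertical_edges G b"
  then obtain u v where e: "{u, v} \<in> E" "e = {u, v}" "d b u < d b v"
    by (auto simp: vertical_edges_def)
  then have "d b v = Suc (d b u)" using edge_d_le[OF assms e(1)] by simp
  then show "\<exists>u v. e = {u, v} \<and> up b u v" using e by (auto simp: up_def)
next
  assume "\<exists>u v. e = {u, v} \<and> up b u v"
  then obtain u v where "e = {u, v}" "{u, v} \<in> E" "d b u < d b v" by (auto simp: up_def)
  then show "e \<in> vertical_edges G b" unfolding vertical_edges_def by blast
qed

lemma verticalE:
  assumes "b \<in> V" "e \<in> vertical_edges G b"
  obtains u v where "e = {u, v}" "up b u v"
  using assms vertical_iff_up by blast

lemma convexD:
  "geodesically_convex G A \<Longrightarrow> x \<in> A \<Longrightarrow> y \<in> A \<Longrightarrow> z \<in> interval G x y \<Longrightarrow> z \<in> A"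
  unfolding geodesically_convex_def by blast

lemma convex_Int:
  "geodesically_convex G A \<Longrightarrow> geodesically_convex G B \<Longrightarrow> geodesically_convex G (A \<inter> B)"
  by (auto simp: geodesically_convex_def)

lemma convex_imp_reach:
  assumes "geodesically_convex G A" "A \<subseteq> S" "x \<in> A" "y \<in> A"
  shows "(x, y) \<in> (adj (induced_subgraph G S))\<^sup>*"
  using assms(4)
proof (induction "d x y" arbitrary: y)
  case 0
  then have "x = y" using d_eq_0[of x y] assms by (auto simp: geodesically_convex_def)
  then show ?case by simp
next
  case (Suc n)
  have xy: "x \<in> V" "y \<in> V" using assms Suc.prems by (auto simp: geodesically_convex_def)
  obtain w where w: "w \<in> V" "{w, y} \<in> E" "d x w = n"
    using d_Suc_predecessor[OF xy Suc.hyps(2)[symmetric]] .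
  then have "w \<in> interval G x y" using Suc.hyps(2) d_edge[OF w(2)] by (simp add: interval_def)
  then have "w \<in> A" by (rule convexD[OF assms(1,3) Suc.prems])
  moreover from this have "(w, y) \<in> adj (induced_subgraph G S)"
    using w Suc.prems assms(2) by (auto simp: adj_def induced_subgraph_def)
  ultimately show ?case using Suc.hyps(1)[of w] w by (auto intro: rtrancl.rtrancl_into_rtrancl)
qed

section \<open>Slopes and walls\<close>

text \<open>The sign of the slope tells on which side of the edge \<open>uv\<close> a vertex lies:
  it is negative on \<open>W_less G u v\<close>, zero on \<open>W_eq G u v\<close> and positive on
  \<open>W_less G v u\<close>. The bracket of two edges is the increment of the slope of one along
  the other (\<open>bracket_slope\<close>), so brackets can be summed along paths.\<close>

definition slope :: "'a \<Rightarrow> 'a \<Rightarrow> 'a \<Rightarrow> int" where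
  "slope u v x = int (d x u) - int (d x v)"

lemma slope_bound:
  assumes "{u, v} \<in> E" "x \<in> V"
  shows "\<bar>slope u v x\<bar> \<le> 1"
  using edge_d_le[OF assms(2), of u v] edge_d_le[OF assms(2), of v u] assms(1)
  by (simp add: slope_def insert_commute)

lemma bracket_slope:
  assumes "{u, v} \<in> E" "{u', v'} \<in> E"
  shows "edge_bracket G u v u' v' = slope u v v' - slope u v u'"
  using d_sym edgeD(1,2)[OF assms(1)] edgeD(1,2)[OF assms(2)]
  by (simp add: edge_bracket_def slope_def)

lemma bracket_sym:
  assumes "{u, v} \<in> E" "{u', v'} \<in> E"
  shows "edge_bracket G u v u' v' = edge_bracket G u' v' u v"
  using d_sym edgeD(1,2)[OF assms(1)] edgeD(1,2)[OF assms(2)]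
  by (simp add: edge_bracket_def)

lemma theta1_iff: "theta1 G {u, v} {u', v'} \<longleftrightarrow> \<bar>edge_bracket G u v u' v'\<bar> = 2"
  unfolding theta1_def
proof
  assume "\<exists>x y x' y'. {u, v} = {x, y} \<and> {u', v'} = {x', y'} \<and> \<bar>edge_bracket G x y x' y'\<bar> = 2"
  then show "\<bar>edge_bracket G u v u' v'\<bar> = 2"
    by (auto simp: doubleton_eq_iff edge_bracket_def)
qed blast

lemma theta2_iff: "theta2 G {u, v} {u', v'} \<longleftrightarrow> \<bar>edge_bracket G u v u' v'\<bar> = 1"
  unfolding theta2_def
proof
  assume "\<exists>x y x' y'. {u, v} = {x, y} \<and> {u', v'} = {x', y'} \<and> \<bar>edge_bracket G x y x' y'\<bar> = 1"
  then show "\<bar>edge_bracket G u v u' v'\<bar> = 1"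
    by (auto simp: doubleton_eq_iff edge_bracket_def)
qed blast

definition halfspace :: "'a set \<Rightarrow> bool" where
  "halfspace H \<longleftrightarrow> complementary_halfspaces G H (V - H)"

text \<open>The two walls of an edge in one formula: each wall that separates a vertex from
  \<open>u\<close> raises the slope by one. All consequences of the wallspace condition are drawn
  from this form, in which the components of \<open>W_eq\<close> no longer occur.\<close>

definition wall_pair :: "'a \<Rightarrow> 'a \<Rightarrow> 'a set \<Rightarrow> 'a set \<Rightarrow> bool" where
  "wall_pair u v H K \<longleftrightarrow> halfspace H \<and> halfspace K \<and>
     (\<forall>x\<in>V. slope u v x = of_bool (x \<notin> H) + of_bool (x \<notin> K) - 1)"

lemma halfspaceD:
  assumes "halfspace H"
  shows "H \<subseteq> V" "geodesically_convex G H"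
  using assms by (auto simp: halfspace_def complementary_halfspaces_def)

text \<open>If \<open>q\<close> were nearer to \<open>x\<close> than \<open>p\<close>, then
  \<open>q\<close> would lie between two vertices of the convex set \<open>H\<close>.\<close>

lemma halfspace_edge:
  assumes H: "halfspace H" and e: "{p, q} \<in> E" and "p \<in> H" "q \<notin> H" "x \<in> H"
  shows "d x p \<le> d x q"
proof (rule ccontr)
  have V: "p \<in> V" "q \<in> V" "x \<in> V"
    using assms edgeD[OF e] halfspaceD(1) by auto
  assume "\<not> d x p \<le> d x q"
  then have "d x p = Suc (d x q)" using edge_d_le[OF V(3), of q p] e by (simp add: insert_commute)
  then have "q \<in> interval G x p"
    using V d_edge[OF e] d_sym[of p q] by (simp add: interval_def)
  then show False
    using convexD[OF halfspaceD(2)[OF H]] assms by blast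
qed

lemma halfspace_compl: "halfspace H \<Longrightarrow> halfspace (V - H)"
proof -
  assume "halfspace H"
  then have "complementary_halfspaces G (V - H) H" "V - (V - H) = H"
    by (auto simp: halfspace_def complementary_halfspaces_def)
  then show ?thesis by (simp add: halfspace_def)
qed

text \<open>A bracket of 2 means that both walls of \<open>uv\<close> separate \<open>u'\<close>
  from \<open>v'\<close>. A vertex strictly on one side of \<open>u'v'\<close> is therefore,
  by \<open>halfspace_edge\<close>, on that side of both walls.\<close>

lemma crossing_slope:
  assumes "wall_pair u v H K" "{u', v'} \<in> E" "x \<in> V"
    and "edge_bracket G u v u' v' = 2" "{u, v} \<in> E"
  shows "slope u' v' x > 0 \<Longrightarrow> slope u v x = 1" "slope u' v' x < 0 \<Longrightarrow> slope u v x = -1"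
proof -
  have H: "halfspace H" "halfspace K" "halfspace (V - H)" "halfspace (V - K)"
    using assms(1) halfspace_compl by (auto simp: wall_pair_def)
  have V': "u' \<in> V" "v' \<in> V" using edgeD[OF assms(2)] by auto
  have s: "slope u v y = of_bool (y \<notin> H) + of_bool (y \<notin> K) - 1" if "y \<in> V" for y
    using assms(1) that by (simp add: wall_pair_def)
  have "slope u v v' - slope u v u' = 2"
    using assms(4) bracket_slope[OF assms(5,2)] by simp
  then have uv: "u' \<in> H" "u' \<in> K" "v' \<notin> H" "v' \<notin> K"
    using s[OF V'(1)] s[OF V'(2)] by (auto simp: of_bool_def split: if_splits)
  have e': "{v', u'} \<in> E" using assms(2) by (simp add: insert_commute)
  show "slope u v x = 1" if "slope u' v' x > 0"
    using that halfspace_edge[OF H(1) assms(2) uv(1,3), of x] s[OF assms(3)]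
      halfspace_edge[OF H(2) assms(2) uv(2,4), of x] by (auto simp: slope_def)
  show "slope u v x = -1" if "slope u' v' x < 0"
    using that halfspace_edge[OF H(3) e', of x] halfspace_edge[OF H(4) e', of x] s[OF assms(3)] uv V' assms(3)
    by (auto simp: slope_def)
qed

text \<open>Brackets are symmetric, so each edge of the pair can play the part of
  \<open>uv\<close> in \<open>crossing_slope\<close>; two functions with values in
  \<open>{-1, 0, 1}\<close> that have the same sign everywhere agree.\<close>

lemma theta1_same_slope:
  assumes walls: "\<And>u v. {u, v} \<in> E \<Longrightarrow> \<exists>H K. wall_pair u v H K"
    and e: "{u, v} \<in> E" "{u', v'} \<in> E" and br: "edge_bracket G u v u' v' = 2" and x: "x \<in> V"
  shows "slope u v x = slope u' v' x"
proof -
  obtain H K H' K' where w: "wall_pair u v H K" "wall_pair u' v' H' K'"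
    using walls e by blast
  have br': "edge_bracket G u' v' u v = 2" using br bracket_sym[OF e] by simp
  show ?thesis
    using crossing_slope[OF w(1) e(2) x br e(1)] crossing_slope[OF w(2) e(1) x br' e(2)]
      slope_bound[OF e(1) x] slope_bound[OF e(2) x]
    by linarith
qed

lemma slope_base:
  assumes "up b u v"
  shows "slope u v b = -1"
  using upD[OF assms] by (simp add: slope_def)

text \<open>The basepoint is on the near side of both walls of \<open>uv\<close>. As
  \<open>p\<close> lies on a geodesic from \<open>b\<close> to \<open>q\<close>, convexity puts it
  on the near side of every such wall that has \<open>q\<close> there: moving upwards never lowers
  the slope.\<close>

lemma up_bracket_nonneg:
  assumes "wall_pair u v H K" "b \<in> V" "up b u v" "up b p q"
  shows "edge_bracket G u v p q \<ge> 0"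
proof -
  have s: "slope u v y = of_bool (y \<notin> H) + of_bool (y \<notin> K) - 1" if "y \<in> V" for y
    using assms(1) that by (simp add: wall_pair_def)
  have b: "b \<in> H" "b \<in> K" using s[OF assms(2)] slope_base[OF assms(3)]
    by (auto simp: of_bool_def split: if_splits)
  have "p \<in> interval G b q" using upD[OF assms(4)] d_edge by (simp add: interval_def)
  then have "q \<in> H \<Longrightarrow> p \<in> H" "q \<in> K \<Longrightarrow> p \<in> K"
    using b assms(1) convexD[OF halfspaceD(2)] unfolding wall_pair_def by blast+
  then show ?thesis
    using s[of p] s[of q] upD[OF assms(4)] bracket_slope[OF upD(1)[OF assms(3)] upD(1)[OF assms(4)]]
    by auto
qed

text \<open>The walls are \<open>W_less G u v\<close> extended by one component of
  \<open>W_eq G u v\<close> each. A vertex of \<open>W_eq\<close> is then cut off from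
  \<open>u\<close> by exactly one of the two, which is the slope zero.\<close>

lemma WC_imp_walls:
  assumes wc: "wallspace_condition G" and e: "{u, v} \<in> E"
  shows "\<exists>H K. wall_pair u v H K"
proof -
  define I where "I = induced_subgraph G (W_eq G u v)"
  define C where "C = components I"
  have I: "simple_graph I" "vertices I = W_eq G u v"
    using simple_induced_subgraph[OF simple] by (auto simp: I_def induced_subgraph_def)
  note wc_uv = wc[unfolded wallspace_condition_def Let_def, THEN spec, THEN spec, THEN mp, OF e,
      folded I_def, folded C_def]
  have C: "finite C" "card C \<le> 2" using wc_uv by simp_all
  have chs: "complementary_halfspaces G (W_less G u v \<union> W') (W_less G v u \<union> W'') \<and>
      complementary_halfspaces G (W_less G u v \<union> W'') (W_less G v u \<union> W')"
    if "W' \<inter> W'' = {}" "{W', W''} - {{}} = C" for W' W''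
    using wc_uv[THEN conjunct2, THEN conjunct2, rule_format, OF conjI[OF that]] .
  have "card C = 0 \<or> card C = 1 \<or> card C = 2" using C(2) by linarith
  then have "\<exists>A B. A \<inter> B = {} \<and> {A, B} - {{}} = C"
  proof (elim disjE)
    assume "card C = 0"
    then have "{} \<inter> {} = {} \<and> {{}, {}} - {{}} = C" using C(1) by simp
    then show ?thesis by metis
  next
    assume "card C = 1"
    then obtain A where "C = {A}" by (auto simp: card_1_singleton_iff)
    then have "A \<inter> {} = {} \<and> {A, {}} - {{}} = C"
      using components_nonempty[OF I(1)] unfolding C_def[symmetric] by auto
    then show ?thesis by metis
  next
    assume "card C = 2"
    then obtain A B where AB: "C = {A, B}" "A \<noteq> B" by (auto simp: card_2_iff)
    then have "A \<inter> B = {} \<and> {A, B} - {{}} = C"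
      using components_nonempty[OF I(1)] components_disjoint[OF I(1), of A B]
      unfolding C_def[symmetric] by auto
    then show ?thesis by metis
  qed
  then obtain A B where AB: "A \<inter> B = {}" "{A, B} - {{}} = C" by blast
  have un: "A \<union> B = W_eq G u v"
  proof -
    have "A \<union> B = \<Union> ({A, B} - {{}})" by auto
    then show ?thesis using AB(2) Union_components[OF I(1)] I(2) by (simp add: C_def)
  qed
  define H where "H = W_less G u v \<union> A"
  define K where "K = W_less G u v \<union> B"
  have ch: "complementary_halfspaces G H (W_less G v u \<union> B)"
    "complementary_halfspaces G K (W_less G v u \<union> A)"
    using chs[OF AB] by (auto simp: H_def K_def)
  then have "V - H = W_less G v u \<union> B" "V - K = W_less G v u \<union> A"
    unfolding complementary_halfspaces_def by blast+
  then have "halfspace H" "halfspace K" using ch by (auto simp: halfspace_def)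
  moreover have "slope u v x = of_bool (x \<notin> H) + of_bool (x \<notin> K) - 1" if "x \<in> V" for x
  proof -
    consider "x \<in> W_less G u v" "x \<notin> W_less G v u" "x \<notin> W_eq G u v"
      | "x \<in> W_less G v u" "x \<notin> W_less G u v" "x \<notin> W_eq G u v"
      | "x \<in> W_eq G u v" "x \<notin> W_less G u v" "x \<notin> W_less G v u"
      using \<open>x \<in> V\<close> by (force simp: W_less_def W_eq_def)
    then show ?thesis
    proof cases
      case 1
      then show ?thesis
        using slope_bound[OF e that] by (auto simp: H_def K_def slope_def W_less_def)
    next
      case 2
      then have "x \<notin> H" "x \<notin> K" using un by (auto simp: H_def K_def)
      then show ?thesis using 2 slope_bound[OF e that] by (auto simp: slope_def W_less_def)
    next
      case 3
      then have "x \<in> H \<longleftrightarrow> x \<notin> K" using un AB(1) by (auto simp: H_def K_def)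
      then show ?thesis using 3 by (auto simp: slope_def W_eq_def)
    qed
  qed
  ultimately show ?thesis unfolding wall_pair_def by blast
qed

section \<open>Atom labellings\<close>

text \<open>The labels are the edges of a bipartite graph with \<open>X\<close> as one part. The
  second condition encodes both relations between edges at once: sharing two, one or no elements
  means being in the same class, in adjacent classes, or in different classes that are not
  adjacent.\<close>

definition atom_labelling :: "'a \<Rightarrow> 'l set \<Rightarrow> ('a set \<Rightarrow> 'l set) \<Rightarrow> bool" where
  "atom_labelling b X l \<longleftrightarrow>
     (\<forall>e\<in>vertical_edges G b. \<exists>x\<in>X. \<exists>y. y \<notin> X \<and> l e = {x, y}) \<and>
     (\<forall>u v u' v'. up b u v \<longrightarrow> up b u' v' \<longrightarrow>
        edge_bracket G u v u' v' = int (card (l {u, v} \<inter> l {u', v'})))"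

lemma labelling_ends:
  assumes "atom_labelling b X l" "e \<in> vertical_edges G b"
  obtains x y where "x \<in> X" "y \<notin> X" "l e = {x, y}"
  using assms unfolding atom_labelling_def by blast

lemma labelling_bracket:
  assumes "atom_labelling b X l" "up b u v" "up b u' v'"
  shows "edge_bracket G u v u' v' = int (card (l {u, v} \<inter> l {u', v'}))"
  using assms unfolding atom_labelling_def by blast

lemma two_set_Int_card:
  assumes "x \<in> X" "y \<notin> X" "x' \<in> X" "y' \<notin> X"
  shows "card ({x, y} \<inter> {x', y'}) = of_bool (x = x') + of_bool (y = y')"
proof -
  have "x \<noteq> y" "x \<noteq> y'" "y \<noteq> x'" using assms by auto
  then show ?thesis by (cases "x = x'"; cases "y = y'") (simp_all add: Int_insert_left)
qed

lemma labelling_theta: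
  assumes b: "b \<in> V" and l: "atom_labelling b X l"
    and e: "e \<in> vertical_edges G b" "e' \<in> vertical_edges G b"
  shows "theta1 G e e' \<longleftrightarrow> l e = l e'"
    "theta2 G e e' \<longleftrightarrow> l e \<noteq> l e' \<and> l e \<inter> l e' \<noteq> {}"
proof -
  obtain u v u' v' where uv: "e = {u, v}" "up b u v" "e' = {u', v'}" "up b u' v'"
    using verticalE[OF b e(1)] verticalE[OF b e(2)] by metis
  obtain x y x' y' where xy: "x \<in> X" "y \<notin> X" "l e = {x, y}" "x' \<in> X" "y' \<notin> X" "l e' = {x', y'}"
    using labelling_ends[OF l e(1)] labelling_ends[OF l e(2)] by metis
  have br: "edge_bracket G u v u' v' = of_bool (x = x') + of_bool (y = y')"
    using labelling_bracket[OF l uv(2,4)] two_set_Int_card[OF xy(1,2,4,5)]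
    unfolding uv(1)[symmetric] uv(3)[symmetric] xy(3,6) by simp
  have ne: "x \<noteq> y'" "y \<noteq> x'" using xy by auto
  show "theta1 G e e' \<longleftrightarrow> l e = l e'"
    unfolding xy(3,6) unfolding uv(1,3) theta1_iff br using ne by (auto simp: doubleton_eq_iff)
  show "theta2 G e e' \<longleftrightarrow> l e \<noteq> l e' \<and> l e \<inter> l e' \<noteq> {}"
    unfolding xy(3,6) unfolding uv(1,3) theta2_iff br using ne by (auto simp: doubleton_eq_iff)
qed

text \<open>The disjunction comes from the unordered pair: the definition of the edge set does not
  say which class of an edge is the first.\<close>

lemma atom_graph_edge_iff:
  "{P, S} \<in> edges (atom_graph G b) \<longleftrightarrow>
     P \<in> vertical_edges G b // theta1_vertical G b \<and>
     S \<in> vertical_edges G b // theta1_vertical G b \<and> P \<noteq> S \<and>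
     ((\<forall>e\<in>P. \<forall>e'\<in>S. theta2 G e e') \<or> (\<forall>e\<in>S. \<forall>e'\<in>P. theta2 G e e'))"
  unfolding atom_graph_def Let_def by (simp add: doubleton_eq_iff) blast

text \<open>Two edges are in the same class exactly if their labels agree, so a class corresponds to
  its label. The labels are the edges of the bipartite graph, with finite part \<open>X\<close>.\<close>

lemma labelling_imp_AGC:
  assumes b: "b \<in> V" and l: "atom_labelling b X l" and X: "finite X"
  shows "atom_graph_condition G b"
proof -
  let ?E0 = "vertical_edges G b"
  let ?R = "theta1_vertical G b"
  have R: "?R = {(e, e'). e \<in> ?E0 \<and> e' \<in> ?E0 \<and> l e = l e'}"
    using labelling_theta(1)[OF b l] by (auto simp: theta1_vertical_def)
  have eq: "equiv ?E0 ?R"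
    unfolding R by (rule equivI) (auto simp: refl_on_def sym_def trans_def)
  \<comment> \<open>All edges in a class have the same label, so the union is that label.\<close>
  define f where "f = (\<lambda>P. \<Union> (l ` P))"
  have fcl: "f (?R `` {e}) = l e" if "e \<in> ?E0" for e
    using that unfolding f_def R by auto
  define D where "D = \<lparr>vertices = X \<union> \<Union> (l ` ?E0), edges = l ` ?E0\<rparr>"
  have bip: "bipartition D X (\<Union> (l ` ?E0) - X)"
    unfolding bipartition_def
  proof (intro conjI ballI)
    fix a assume "a \<in> edges D"
    then obtain e where e: "e \<in> ?E0" "a = l e" by (auto simp: D_def)
    obtain x y where xy: "x \<in> X" "y \<notin> X" "l e = {x, y}"
      using labelling_ends[OF l e(1)] .
    then have "y \<in> \<Union> (l ` ?E0) - X" using e by auto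
    then show "\<exists>x\<in>X. \<exists>y\<in>\<Union> (l ` ?E0) - X. a = {x, y}" using xy e by blast
  qed (auto simp: D_def)
  have Q: "vertices (atom_graph G b) = ?E0 // ?R"
    by (simp add: atom_graph_def Let_def)
  have adj: "{P, S} \<in> edges (atom_graph G b) \<longleftrightarrow> P \<noteq> S \<and> (\<forall>e\<in>P. \<forall>e'\<in>S. theta2 G e e')"
    if "P \<in> ?E0 // ?R" "S \<in> ?E0 // ?R" for P S
  proof -
    have sym2: "theta2 G e e' \<longleftrightarrow> theta2 G e' e" if "e \<in> ?E0" "e' \<in> ?E0" for e e'
      using labelling_theta(2)[OF b l] that by (metis Int_commute)
    have sub: "P \<subseteq> ?E0" "S \<subseteq> ?E0" using that eq in_quotient_imp_subset by blast+
    show ?thesis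
      using that sym2 sub unfolding atom_graph_edge_iff by (meson subsetD)
  qed
  have "graph_isomorphic (atom_graph G b) (line_graph D)"
    unfolding graph_isomorphic_def
  proof (intro exI[of _ f] conjI ballI)
    show "bij_betw f (vertices (atom_graph G b)) (vertices (line_graph D))"
      unfolding bij_betw_def Q
    proof
      show "inj_on f (?E0 // ?R)"
      proof (rule inj_onI)
        fix P S assume PS: "P \<in> ?E0 // ?R" "S \<in> ?E0 // ?R" "f P = f S"
        then obtain e e' where e: "e \<in> ?E0" "P = ?R `` {e}" "e' \<in> ?E0" "S = ?R `` {e'}"
          by (metis quotientE)
        then have "l e = l e'" using fcl PS by simp
        then show "P = S" using e eq by (simp add: R equiv_class_eq)
      qed
      show "f ` (?E0 // ?R) = vertices (line_graph D)"
        using fcl by (force simp: quotient_def line_graph_def D_def)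
    qed
  next
    fix P S assume PS: "P \<in> vertices (atom_graph G b)" "S \<in> vertices (atom_graph G b)"
    then obtain e e' where e: "e \<in> ?E0" "P = ?R `` {e}" "e' \<in> ?E0" "S = ?R `` {e'}"
      unfolding Q by (metis quotientE)
    have mem: "c \<in> ?E0 \<and> l c = l e" if "c \<in> P" for c using that e by (auto simp: R)
    have mem': "c \<in> ?E0 \<and> l c = l e'" if "c \<in> S" for c using that e by (auto simp: R)
    have in': "e \<in> P" "e' \<in> S" using e by (auto simp: R)
    have "P = S \<longleftrightarrow> (e, e') \<in> ?R"
      unfolding e(2,4) by (rule eq_equiv_class_iff[OF eq e(1,3)])
    then have "P = S \<longleftrightarrow> l e = l e'" using e(1,3) by (simp add: R)
    moreover have "(\<forall>c\<in>P. \<forall>c'\<in>S. theta2 G c c') \<longleftrightarrow> l e \<noteq> l e' \<and> l e \<inter> l e' \<noteq> {}"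
      using labelling_theta(2)[OF b l] mem mem' in' by (metis (no_types, lifting))
    moreover have "f P = l e" "f S = l e'" using fcl e by auto
    ultimately show "{P, S} \<in> edges (atom_graph G b) \<longleftrightarrow> {f P, f S} \<in> edges (line_graph D)"
      using adj[of P S] PS Q e by (auto simp: line_graph_edges D_def)
  qed
  then show ?thesis
    using semifinite_bipartite_line_graph_any_type[OF bip] X eq
    by (simp add: atom_graph_condition_def atom_graph_well_defined_def)
qed

lemma bipartition_sym: "bipartition D X Y \<Longrightarrow> bipartition D Y X"
  unfolding bipartition_def by (metis Int_commute Un_commute insert_commute)

text \<open>An isomorphism onto a line graph determines the bracket of two upward edges only up to
  sign and up to the choice of representatives of their classes. The wallspace condition settles
  both points: brackets of upward edges are not negative (\<open>up_bracket_nonneg\<close>), and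
  they depend on the classes alone because related edges have the same slope
  (\<open>theta1_same_slope\<close>).\<close>

lemma AGC_imp_labelling:
  assumes b: "b \<in> V" and wc: "wallspace_condition G" and agc: "atom_graph_condition G b"
  shows "\<exists>(X :: ('a set set \<times> bool) set) l. finite X \<and> atom_labelling b X l"
proof -
  let ?E0 = "vertical_edges G b"
  let ?R = "theta1_vertical G b"
  have eq: "equiv ?E0 ?R"
    using agc by (simp add: atom_graph_condition_def atom_graph_well_defined_def)
  \<comment> \<open>The parts are interchangeable, so the finite one can be taken to be \<open>X\<close>.\<close>
  obtain D :: "('a set set \<times> bool) sgraph" and X Y where bip: "bipartition D X Y"
    and X: "finite X" and iso: "graph_isomorphic (atom_graph G b) (line_graph D)"
    using agc bipartition_sym
    unfolding atom_graph_condition_def semifinite_bipartite_line_graph_def by metis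
  obtain f where f: "bij_betw f (?E0 // ?R) (edges D)"
    and fadj: "\<And>P S. P \<in> ?E0 // ?R \<Longrightarrow> S \<in> ?E0 // ?R \<Longrightarrow>
      {P, S} \<in> edges (atom_graph G b) \<longleftrightarrow> {f P, f S} \<in> edges (line_graph D)"
    using iso by (auto simp: graph_isomorphic_def atom_graph_def line_graph_def Let_def)
  define l where "l = (\<lambda>e. f (?R `` {e}))"
  have lE: "l e \<in> edges D" if "e \<in> ?E0" for e
    using f that by (auto simp: l_def bij_betw_def quotientI)
  have ends: "\<exists>x\<in>X. \<exists>y. y \<notin> X \<and> l e = {x, y}" if "e \<in> ?E0" for e
  proof -
    have "\<forall>a\<in>edges D. \<exists>x\<in>X. \<exists>y\<in>Y. a = {x, y}" "X \<inter> Y = {}"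
      using bip[unfolded bipartition_def, THEN conjunct2] by (rule conjunct2, rule conjunct1)
    then obtain x y where "x \<in> X" "y \<in> Y" "l e = {x, y}" "y \<notin> X"
      using lE[OF \<open>e \<in> ?E0\<close>] by (meson disjoint_iff)
    then show ?thesis by metis
  qed
  have br_nonneg: "edge_bracket G u v u' v' \<ge> 0" if "up b u v" "up b u' v'" for u v u' v'
    using WC_imp_walls[OF wc upD(1)[OF that(1)]] up_bracket_nonneg[OF _ b that] by blast
  have br_le: "edge_bracket G u v u' v' \<le> 2" if "up b u v" "up b u' v'" for u v u' v'
    using bracket_slope[OF upD(1)[OF that(1)] upD(1)[OF that(2)]]
      slope_bound[OF upD(1)[OF that(1)], of u'] slope_bound[OF upD(1)[OF that(1)], of v']
      upD[OF that(2)] by linarith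
  have vert: "{u, v} \<in> ?E0" if "up b u v" for u v
    using vertical_iff_up[OF b] that by blast
  have R_iff: "({u, v}, {u', v'}) \<in> ?R \<longleftrightarrow> edge_bracket G u v u' v' = 2"
    if "up b u v" "up b u' v'" for u v u' v'
    using vert[OF that(1)] vert[OF that(2)] br_nonneg[OF that]
    by (auto simp: theta1_vertical_def theta1_iff)
  have class_br: "edge_bracket G u v u' v' = edge_bracket G p q p' q'"
    if up: "up b u v" "up b u' v'" "up b p q" "up b p' q'"
      and R: "({u, v}, {p, q}) \<in> ?R" "({u', v'}, {p', q'}) \<in> ?R" for u v u' v' p q p' q'
  proof -
    have sl: "slope u v z = slope p q z" "slope u' v' z = slope p' q' z" if "z \<in> V" for z
      using theta1_same_slope[OF WC_imp_walls[OF wc]] R_iff up R upD(1) that by blast+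
    have "edge_bracket G u v u' v' = edge_bracket G p q u' v'"
      using bracket_slope upD[OF up(1)] upD[OF up(2)] upD[OF up(3)] sl(1) by simp
    also have "\<dots> = edge_bracket G u' v' p q"
      using bracket_sym upD[OF up(2)] upD[OF up(3)] by simp
    also have "\<dots> = edge_bracket G p' q' p q"
      using bracket_slope upD[OF up(2)] upD[OF up(3)] upD[OF up(4)] sl(2) by simp
    also have "\<dots> = edge_bracket G p q p' q'"
      using bracket_sym upD[OF up(3)] upD[OF up(4)] by simp
    finally show ?thesis .
  qed
  have "edge_bracket G u v u' v' = int (card (l {u, v} \<inter> l {u', v'}))"
    if up: "up b u v" "up b u' v'" for u v u' v'
  proof -
    let ?P = "?R `` {{u, v}}" and ?S = "?R `` {{u', v'}}"
    have PS: "?P \<in> ?E0 // ?R" "?S \<in> ?E0 // ?R" using vert up by (auto intro: quotientI)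
    have same: "l {u, v} = l {u', v'} \<longleftrightarrow> edge_bracket G u v u' v' = 2"
    proof -
      have "l {u, v} = l {u', v'} \<longleftrightarrow> ?P = ?S"
        using f PS by (auto simp: l_def bij_betw_def dest: inj_onD)
      then show ?thesis
        using eq_equiv_class_iff[OF eq] vert up R_iff[OF up] by simp
    qed
    have all: "(\<forall>e\<in>?P. \<forall>e'\<in>?S. theta2 G e e') \<longleftrightarrow> edge_bracket G u v u' v' = 1"
    proof
      assume "\<forall>e\<in>?P. \<forall>e'\<in>?S. theta2 G e e'"
      then have "theta2 G {u, v} {u', v'}"
        using equiv_class_self[OF eq] vert up by blast
      then show "edge_bracket G u v u' v' = 1" using br_nonneg[OF up] by (simp add: theta2_iff)
    next
      assume br: "edge_bracket G u v u' v' = 1"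
      show "\<forall>e\<in>?P. \<forall>e'\<in>?S. theta2 G e e'"
      proof (intro ballI)
        fix e e' assume ee: "e \<in> ?P" "e' \<in> ?S"
        then have "e \<in> ?E0" "e' \<in> ?E0" by (auto simp: theta1_vertical_def)
        then obtain p q p' q' where pq: "e = {p, q}" "up b p q" "e' = {p', q'}" "up b p' q'"
          using verticalE[OF b] by metis
        then have "edge_bracket G p q p' q' = 1" using class_br[OF up pq(2,4)] ee br by simp
        then show "theta2 G e e'" by (simp add: pq theta2_iff)
      qed
    qed
    have edge: "{?P, ?S} \<in> edges (atom_graph G b) \<longleftrightarrow> edge_bracket G u v u' v' = 1"
    proof
      assume "{?P, ?S} \<in> edges (atom_graph G b)"
      then consider "\<forall>e\<in>?P. \<forall>e'\<in>?S. theta2 G e e'" | "\<forall>e\<in>?S. \<forall>e'\<in>?P. theta2 G e e'"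
        unfolding atom_graph_edge_iff by blast
      then show "edge_bracket G u v u' v' = 1"
      proof cases
        case 2
        then have "theta2 G {u', v'} {u, v}" using equiv_class_self[OF eq] vert up by blast
        then show ?thesis
          using br_nonneg[OF up] bracket_sym[OF upD(1)[OF up(1)] upD(1)[OF up(2)]]
          by (simp add: theta2_iff)
      qed (use all in blast)
    next
      assume br: "edge_bracket G u v u' v' = 1"
      then have "?P \<noteq> ?S" using same by (auto simp: l_def)
      then show "{?P, ?S} \<in> edges (atom_graph G b)"
        using PS all br unfolding atom_graph_edge_iff by blast
    qed
    have one: "edge_bracket G u v u' v' = 1 \<longleftrightarrow>
        l {u, v} \<noteq> l {u', v'} \<and> l {u, v} \<inter> l {u', v'} \<noteq> {}"
      using fadj[OF PS] edge lE[OF vert[OF up(1)]] lE[OF vert[OF up(2)]]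
      by (auto simp: line_graph_edges l_def)
    obtain x y x' y' where xy: "x \<in> X" "y \<notin> X" "l {u, v} = {x, y}"
      "x' \<in> X" "y' \<notin> X" "l {u', v'} = {x', y'}"
      using ends vert up by meson
    have ne: "x \<noteq> y'" "y \<noteq> x'" using xy by auto
    have "edge_bracket G u v u' v' = of_bool (x = x') + of_bool (y = y')"
    proof -
      have "edge_bracket G u v u' v' = 2 \<longleftrightarrow> x = x' \<and> y = y'"
        using same ne unfolding xy(3,6) doubleton_eq_iff by metis
      moreover have "edge_bracket G u v u' v' = 1 \<longleftrightarrow> (x = x') \<noteq> (y = y')"
      proof -
        have "{x, y} \<inter> {x', y'} \<noteq> {} \<longleftrightarrow> x = x' \<or> y = y'" using ne by blast
        then show ?thesis using one ne unfolding xy(3,6) doubleton_eq_iff by metis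
      qed
      ultimately show ?thesis
        using br_nonneg[OF up] br_le[OF up] by (cases "x = x'"; cases "y = y'") simp_all
    qed
    then show ?thesis using two_set_Int_card[OF xy(1,2,4,5)] xy(3,6) by simp
  qed
  then have "atom_labelling b X l" using ends by (simp add: atom_labelling_def)
  then show ?thesis using X by blast
qed

section \<open>From labellings to embeddings\<close>

lemma geodesic_sum_slope:
  assumes b: "b \<in> V" and w: "w 0 = b" "w n = v" "\<forall>k<n. up b (w k) (w (Suc k))" and x: "x \<in> V"
  shows "(\<Sum>k<n. slope (w k) (w (Suc k)) x) = int (d x b) - int (d x v)"
proof -
  have "(\<Sum>k<n. int (d x (w k)) - int (d x (w (Suc k)))) = int (d x (w 0)) - int (d x (w n))"
    by (rule sum_lessThan_telescope')
  then show ?thesis using w by (simp add: slope_def)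
qed

text \<open>In terms of the embedding that is to be built, \<open>S\<close> is the set of
  elements at which the image of \<open>v\<close> differs from that of the basepoint: its elements
  in the label of an edge count the walls of that edge between \<open>b\<close> and
  \<open>v\<close>.\<close>

definition counts_slopes :: "'a \<Rightarrow> ('a set \<Rightarrow> 'l set) \<Rightarrow> 'l set \<Rightarrow> 'a \<Rightarrow> bool" where
  "counts_slopes b l S v \<longleftrightarrow>
     (\<forall>p q. up b p q \<longrightarrow> slope p q v = int (card (l {p, q} \<inter> S)) - 1)"

text \<open>\<open>S\<close> is the union of the labels along a geodesic from \<open>b\<close> to
  \<open>v\<close>. For an upward edge \<open>pq\<close>, the brackets with the edges of the
  geodesic add up to \<open>slope p q v - slope p q b = slope p q v + 1\<close>, which is at most
  2; applied to an edge of the geodesic itself, this forces the labels to be disjoint. Summing the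
  slopes of the edges of the geodesic at another vertex \<open>u\<close> gives the distance formula.
  That formula holds for every set \<open>T\<close> that counts the slopes at \<open>u\<close>, so the geodesics
  to \<open>u\<close> and to \<open>v\<close> can be chosen independently.\<close>

lemma labelling_support:
  assumes b: "b \<in> V" and l: "atom_labelling b X l" and v: "v \<in> V"
  shows "\<exists>S. (finite S \<and> card (S \<inter> X) = d b v \<and> card (S - X) = d b v) \<and>
    counts_slopes b l S v \<and>
    (\<forall>u\<in>V. \<forall>T. counts_slopes b l T u \<longrightarrow> d u v + card (T \<inter> S) = d b u + d b v)"
proof -
  define n where "n = d b v"
  obtain w where w: "w 0 = b" "w n = v" and wup: "\<And>k. k < n \<Longrightarrow> up b (w k) (w (Suc k))"
    using geodesic_exists[OF b v] unfolding n_def by blast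
  define M where "M = (\<lambda>k. l {w k, w (Suc k)})"
  define S where "S = (\<Union>k<n. M k)"
  have M: "\<exists>x\<in>X. \<exists>y. y \<notin> X \<and> M k = {x, y}" if "k < n" for k
    using labelling_ends[OF l, of "{w k, w (Suc k)}"] wup[OF that] vertical_iff_up[OF b]
    unfolding M_def by metis
  have finM: "finite (M k)" if "k < n" for k using M[OF that] by auto
  have wV: "w k \<in> V" if "k \<le> n" for k
    using that w upD(2)[OF wup[of k]] v by (cases "k = n") auto
  have sum_slope: "(\<Sum>k<n. int (card (l {p, q} \<inter> M k))) = slope p q v + 1" if pq: "up b p q" for p q
  proof -
    have "int (card (l {p, q} \<inter> M k)) = slope p q (w (Suc k)) - slope p q (w k)" if "k < n" for k
      using labelling_bracket[OF l pq wup[OF that]]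
        bracket_slope[OF upD(1)[OF pq] upD(1)[OF wup[OF that]]]
      by (simp add: M_def)
    then have "(\<Sum>k<n. int (card (l {p, q} \<inter> M k))) =
        (\<Sum>k<n. slope p q (w (Suc k)) - slope p q (w k))" by simp
    also have "\<dots> = slope p q v - slope p q b"
      using sum_lessThan_telescope[of "\<lambda>k. slope p q (w k)" n] w by simp
    finally show ?thesis using slope_base[OF pq] by simp
  qed
  have disj: "M j \<inter> M k = {}" if jk: "j < n" "k < n" "j \<noteq> k" for j k
  proof -
    \<comment> \<open>The bracket of the edge number \<open>j\<close> with itself uses up the whole bound 2.\<close>
    have "(\<Sum>i\<in>{j, k}. int (card (M j \<inter> M i))) \<le> (\<Sum>i<n. int (card (M j \<inter> M i)))"
      using jk by (intro sum_mono2) auto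
    also have "\<dots> \<le> 2"
      using sum_slope[OF wup[OF jk(1)]] slope_bound[OF upD(1)[OF wup[OF jk(1)]] v]
      by (simp add: M_def)
    finally have "int (card (M j)) + int (card (M j \<inter> M k)) \<le> 2" using jk by simp
    moreover have "card (M j) = 2" using M[OF jk(1)] by (auto simp: card_2_iff)
    ultimately show ?thesis using finM[OF jk(1)] by simp
  qed
  have cardB: "card (S \<inter> B) = (\<Sum>k<n. card (M k \<inter> B))" for B
  proof -
    have "S \<inter> B = (\<Union>k<n. M k \<inter> B)" by (auto simp: S_def)
    moreover have "card (\<Union>k<n. M k \<inter> B) = (\<Sum>k<n. card (M k \<inter> B))"
      using finM disj by (intro card_UN_disjoint) (simp, simp, blast)
    ultimately show ?thesis by simp
  qed
  have fS: "finite S" using finM by (auto simp: S_def)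
  have "card (M k \<inter> X) = 1" "card (M k \<inter> - X) = 1" if "k < n" for k
  proof -
    obtain x y where "x \<in> X" "y \<notin> X" "M k = {x, y}" using M[OF \<open>k < n\<close>] by blast
    then have "M k \<inter> X = {x}" "M k \<inter> - X = {y}" by auto
    then show "card (M k \<inter> X) = 1" "card (M k \<inter> - X) = 1" by simp_all
  qed
  then have "card (S \<inter> X) = n" "card (S - X) = n"
    using cardB[of X] cardB[of "- X"] by (simp_all add: Diff_eq)
  moreover have "counts_slopes b l S v"
    unfolding counts_slopes_def
  proof (intro allI impI)
    fix p q assume "up b p q"
    then show "slope p q v = int (card (l {p, q} \<inter> S)) - 1"
      using sum_slope[of p q] cardB[of "l {p, q}"] by (simp add: Int_commute)
  qed
  moreover have "d u v + card (T \<inter> S) = d b u + d b v"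
    if u: "u \<in> V" and T: "counts_slopes b l T u" for u T
  proof -
    have "int (d u b) - int (d u v) = (\<Sum>k<n. slope (w k) (w (Suc k)) u)"
      using geodesic_sum_slope[OF b w _ u] wup by simp
    also have "\<dots> = (\<Sum>k<n. int (card (M k \<inter> T)) - 1)"
      using T wup by (intro sum.cong) (auto simp: counts_slopes_def M_def)
    also have "\<dots> = int (card (S \<inter> T)) - int n"
      using cardB[of T] by (simp add: sum_subtractf)
    finally show ?thesis using d_sym[OF u b] by (simp add: Int_commute n_def)
  qed
  ultimately show ?thesis using fS unfolding n_def[symmetric] by blast
qed

text \<open>Half of \<open>card (S u \<inter> S v)\<close> is the Gromov product of \<open>u\<close>
  and \<open>v\<close> at \<open>b\<close>.\<close>

lemma labelling_gromov:
  assumes b: "b \<in> V" and l: "atom_labelling b X l"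
  shows "\<exists>S. (\<forall>v\<in>V. finite (S v) \<and> card (S v \<inter> X) = d b v \<and> card (S v - X) = d b v) \<and>
    (\<forall>u\<in>V. \<forall>v\<in>V. d u v + card (S u \<inter> S v) = d b u + d b v)"
proof -
  define Q where "Q = (\<lambda>v S. (finite S \<and> card (S \<inter> X) = d b v \<and> card (S - X) = d b v) \<and>
    counts_slopes b l S v \<and>
    (\<forall>u\<in>V. \<forall>T. counts_slopes b l T u \<longrightarrow> d u v + card (T \<inter> S) = d b u + d b v))"
  have "\<forall>v\<in>V. \<exists>S. Q v S"
    unfolding Q_def by (rule ballI) (rule labelling_support[OF b l])
  then obtain S where S: "\<forall>v\<in>V. Q v (S v)" by (rule bchoice[THEN exE])
  have "d u v + card (S u \<inter> S v) = d b u + d b v" if uv: "u \<in> V" "v \<in> V" for u v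
    using S[THEN bspec, OF uv(1)] S[THEN bspec, OF uv(2)] uv(1) unfolding Q_def by (elim conjE) simp
  moreover have "finite (S v) \<and> card (S v \<inter> X) = d b v \<and> card (S v - X) = d b v" if "v \<in> V" for v
    using S[THEN bspec, OF that] unfolding Q_def by (rule conjunct1)
  ultimately show ?thesis by blast
qed

text \<open>Each \<open>S v\<close> has as many elements inside \<open>X\<close> as outside, so the
  symmetric difference with \<open>X\<close> has the cardinality of \<open>X\<close>. This is where
  \<open>X\<close> must be finite.\<close>

lemma labelling_imp_embeddable:
  fixes X :: "'l set"
  assumes b: "b \<in> V" and l: "atom_labelling b X l" and X: "finite X"
  shows "johnson_embeddable G"
proof -
  obtain S where S: "\<And>v. v \<in> V \<Longrightarrow> finite (S v)" "\<And>v. v \<in> V \<Longrightarrow> card (S v \<inter> X) = d b v"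
      "\<And>v. v \<in> V \<Longrightarrow> card (S v - X) = d b v"
    and dS: "\<And>u v. u \<in> V \<Longrightarrow> v \<in> V \<Longrightarrow> d u v + card (S u \<inter> S v) = d b u + d b v"
    using labelling_gromov[OF b l] by metis
  define f where "f = (\<lambda>v. (X - S v) \<union> (S v - X))"
  \<comment> \<open>A graph with a single vertex may have \<open>X = {}\<close>; the common element
    \<open>None\<close> keeps the order of the Johnson graph positive.\<close>
  define g where "g = (\<lambda>v. insert None (Some ` f v))"
  let ?J = "johnson_graph (Suc (card X)) (UNIV :: 'l option set)"
  have finf: "finite (f v)" if "v \<in> V" for v using S(1)[OF that] X by (simp add: f_def)
  have cardf: "card (f v) = card X" if "v \<in> V" for v
  proof -
    have "card (f v) = card (X - S v) + card (S v - X)"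
      unfolding f_def using S(1)[OF that] X by (intro card_Un_disjoint) auto
    also have "card (X - S v) = card X - d b v"
      using S(2)[OF that] X by (simp add: card_Diff_subset_Int Int_commute)
    moreover have "d b v \<le> card X" using S(2)[OF that] X by (metis card_mono inf_le2)
    ultimately show ?thesis using S(3)[OF that] by simp
  qed
  have gJ: "g v \<in> vertices ?J" if "v \<in> V" for v
    using finf[OF that] cardf[OF that] by (simp add: johnson_vertices g_def card_image)
  have "gdist ?J (g u) (g v) = d u v" if uv: "u \<in> V" "v \<in> V" for u v
  proof -
    have fin: "finite (S u)" "finite (S v)" using S uv by auto
    have "f u - f v = ((S v \<inter> X) - (S u \<inter> S v \<inter> X)) \<union> ((S u - X) - ((S u \<inter> S v) - X))"
      by (auto simp: f_def)
    then have "card (f u - f v) =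
        card ((S v \<inter> X) - (S u \<inter> S v \<inter> X)) + card ((S u - X) - ((S u \<inter> S v) - X))"
      using fin by (simp, intro card_Un_disjoint) auto
    also have "card ((S v \<inter> X) - (S u \<inter> S v \<inter> X)) = card (S v \<inter> X) - card (S u \<inter> S v \<inter> X)"
      using fin by (intro card_Diff_subset) auto
    also have "card ((S u - X) - ((S u \<inter> S v) - X)) = card (S u - X) - card ((S u \<inter> S v) - X)"
      using fin by (intro card_Diff_subset) auto
    finally have diff: "card (f u - f v) =
        (d b v - card (S u \<inter> S v \<inter> X)) + (d b u - card ((S u \<inter> S v) - X))"
      using S uv by simp
    have "card (S u \<inter> S v \<inter> X) \<le> card (S v \<inter> X)" "card ((S u \<inter> S v) - X) \<le> card (S u - X)"
      using fin by (auto intro!: card_mono)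
    then have le: "card (S u \<inter> S v \<inter> X) \<le> d b v" "card ((S u \<inter> S v) - X) \<le> d b u"
      using S uv by auto
    have "card (S u \<inter> S v) = card (S u \<inter> S v \<inter> X) + card ((S u \<inter> S v) - X)"
      using fin by (subst card_Un_disjoint[symmetric]) (auto intro!: arg_cong[where f=card])
    then have "card (f u - f v) = d u v" using diff le dS[OF uv] by linarith
    moreover have "g u - g v = Some ` (f u - f v)" by (auto simp: g_def)
    ultimately show ?thesis
      using gdist_johnson[OF gJ[OF uv(1)] gJ[OF uv(2)]] by (simp add: card_image)
  qed
  then have "isometrically_embeddable G ?J"
    unfolding isometrically_embeddable_def using gJ by blast
  then show ?thesis by (intro johnson_embeddable_any_type) simp_all
qed

end

section \<open>From embeddings to walls and labellings\<close>

locale johnson_embedded_graph = metric_graph G for G :: "'a sgraph" +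
  fixes f :: "'a \<Rightarrow> 'l set" and m :: nat
  assumes fin: "v \<in> vertices G \<Longrightarrow> finite (f v)"
    and card_f: "v \<in> vertices G \<Longrightarrow> card (f v) = m"
    and dist: "u \<in> vertices G \<Longrightarrow> v \<in> vertices G \<Longrightarrow> gdist G u v = card (f u - f v)"
begin

text \<open>The distances from \<open>x\<close> are \<open>m - card (f x \<inter> f u)\<close> and
  \<open>m - card (f x \<inter> f v)\<close>, and the intersections can differ only in
  \<open>i\<close> and \<open>j\<close>.\<close>

lemma edge_swap:
  assumes "{u, v} \<in> E"
  obtains i j where "f u - f v = {i}" "f v - f u = {j}" "i \<noteq> j"
    "\<And>x. x \<in> V \<Longrightarrow> slope u v x = of_bool (j \<in> f x) - of_bool (i \<in> f x)"
proof -
  have V: "u \<in> V" "v \<in> V" using edgeD[OF assms] by auto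
  have "card (f u - f v) = 1" "card (f v - f u) = 1"
    using d_edge[OF assms] dist[OF V] d_sym[OF V] dist[OF V(2,1)] by auto
  then obtain i j where ij: "f u - f v = {i}" "f v - f u = {j}"
    by (auto simp: card_1_singleton_iff)
  then have inj: "i \<in> f u" "i \<notin> f v" "j \<in> f v" "j \<notin> f u" by auto
  have "slope u v x = of_bool (j \<in> f x) - of_bool (i \<in> f x)" if x: "x \<in> V" for x
  proof -
    have eq: "card (f x - f y) + card (f x \<inter> f y) = m" for y
    proof -
      have "card (f x - f y) + card (f x \<inter> f y) = card ((f x - f y) \<union> (f x \<inter> f y))"
        using fin[OF x] by (subst card_Un_disjoint) auto
      then show ?thesis using card_f[OF x] by (simp add: Un_Diff_Int)
    qed
    have ins: "card (f x \<inter> insert k C) = card (f x \<inter> C) + of_bool (k \<in> f x)" if "k \<notin> C" for k C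
      using fin[OF x] that by (simp add: Int_insert_right)
    have "insert i (f u \<inter> f v) = f u" "insert j (f u \<inter> f v) = f v" using ij by blast+
    then have cu: "card (f x \<inter> f u) = card (f x \<inter> (f u \<inter> f v)) + of_bool (i \<in> f x)"
      and cv: "card (f x \<inter> f v) = card (f x \<inter> (f u \<inter> f v)) + of_bool (j \<in> f x)"
      using ins[of i "f u \<inter> f v"] ins[of j "f u \<inter> f v"] inj by simp_all
    show ?thesis
      unfolding slope_def dist[OF x V(1)] dist[OF x V(2)]
      using eq[of u] eq[of v] cu cv by (auto simp: of_bool_def split: if_splits)
  qed
  moreover have "i \<noteq> j" using inj by blast
  ultimately show thesis using that ij by blast
qed

text \<open>Along a geodesic no element is exchanged twice: if \<open>z\<close> is between
  \<open>x\<close> and \<open>y\<close>, then \<open>f x - f y\<close> is the whole union of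
  \<open>f x - f z\<close> and \<open>f z - f y\<close>, by cardinalities.\<close>

lemma coordinate_convex:
  "geodesically_convex G {x \<in> V. i \<in> f x}" "geodesically_convex G {x \<in> V. i \<notin> f x}"
proof -
  have *: "i \<in> f x - f y"
    if xyz: "x \<in> V" "y \<in> V" "z \<in> interval G x y" and i: "i \<in> (f x - f z) \<union> (f z - f y)" for x y z
  proof (rule ccontr)
    have z: "z \<in> V" and eq: "card (f x - f z) + card (f z - f y) = card (f x - f y)"
      using xyz dist by (auto simp: interval_def)
    assume "i \<notin> f x - f y"
    then have "f x - f y \<subset> (f x - f z) \<union> (f z - f y)" using i by blast
    then have "card (f x - f y) < card ((f x - f z) \<union> (f z - f y))"
      using fin xyz z by (intro psubset_card_mono) auto
    also have "\<dots> \<le> card (f x - f z) + card (f z - f y)" by (rule card_Un_le)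
    finally show False using eq by simp
  qed
  show "geodesically_convex G {x \<in> V. i \<in> f x}" "geodesically_convex G {x \<in> V. i \<notin> f x}"
    unfolding geodesically_convex_def using * by (fastforce simp: interval_def)+
qed

text \<open>For an edge that replaces \<open>i\<close> by \<open>j\<close>, the set \<open>W_eq\<close>
  consists of the vertices whose images contain both elements and those whose images contain
  neither. Both parts are convex, hence connected, and no edge joins them because an edge removes
  only one element.\<close>

lemma embedded_WC: "wallspace_condition G"
  unfolding wallspace_condition_def Let_def
proof (intro allI impI)
  fix u v assume e: "{u, v} \<in> E"
  obtain i j where ij: "f u - f v = {i}" "f v - f u = {j}" "i \<noteq> j"
    and sl: "\<And>x. x \<in> V \<Longrightarrow> slope u v x = of_bool (j \<in> f x) - of_bool (i \<in> f x)"
    using edge_swap[OF e] by metis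
  define H where "H = {x \<in> V. i \<in> f x}"
  define H' where "H' = {x \<in> V. i \<notin> f x}"
  define K where "K = {x \<in> V. j \<in> f x}"
  define K' where "K' = {x \<in> V. j \<notin> f x}"
  note defs = H_def H'_def K_def K'_def
  have conv: "geodesically_convex G H" "geodesically_convex G H'"
      "geodesically_convex G K" "geodesically_convex G K'"
    using coordinate_convex by (auto simp: defs)
  define A where "A = H \<inter> K"
  define B where "B = H' \<inter> K'"
  have cAB: "geodesically_convex G A" "geodesically_convex G B"
    using convex_Int conv by (auto simp: A_def B_def)
  have W: "x \<in> W_less G u v \<longleftrightarrow> slope u v x < 0" "x \<in> W_less G v u \<longleftrightarrow> slope u v x > 0"
    "x \<in> W_eq G u v \<longleftrightarrow> slope u v x = 0" if "x \<in> V" for x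
    using that by (auto simp: W_less_def W_eq_def slope_def)
  have WV: "W_less G u v \<subseteq> V" "W_less G v u \<subseteq> V" "W_eq G u v \<subseteq> V"
    by (auto simp: W_less_def W_eq_def)
  have Weq: "W_less G u v = H \<inter> K'" "W_less G v u = H' \<inter> K" "W_eq G u v = A \<union> B"
    using WV W sl by (auto simp: defs A_def B_def of_bool_def split: if_splits)
  let ?I = "induced_subgraph G (W_eq G u v)"
  have "components ?I = {A, B} - {{}}"
  proof (rule components_two_pieces)
    show "simple_graph ?I" using simple_induced_subgraph[OF simple] .
    show "vertices ?I = A \<union> B" using Weq by (simp add: induced_subgraph_def)
    show "A \<inter> B = {}" by (auto simp: A_def B_def defs)
    show "(x, y) \<in> (adj ?I)\<^sup>*" if "x \<in> A" "y \<in> A" for x y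
      using convex_imp_reach[OF cAB(1) _ that] Weq by simp
    show "(x, y) \<in> (adj ?I)\<^sup>*" if "x \<in> B" "y \<in> B" for x y
      using convex_imp_reach[OF cAB(2) _ that] Weq by simp
    show "{x, y} \<notin> edges ?I" if xy: "x \<in> A" "y \<in> B" for x y
    proof
      assume "{x, y} \<in> edges ?I"
      then have "{x, y} \<in> E" by (simp add: induced_subgraph_def)
      then obtain a where "f x - f y = {a}" using edge_swap by metis
      moreover have "i \<in> f x - f y" "j \<in> f x - f y" using xy by (auto simp: A_def B_def defs)
      ultimately show False using ij(3) by auto
    qed
  qed
  moreover have "complementary_halfspaces G (W_less G u v \<union> W') (W_less G v u \<union> W'') \<and>
      complementary_halfspaces G (W_less G u v \<union> W'') (W_less G v u \<union> W')"
    if W: "W' \<inter> W'' = {}" "{W', W''} - {{}} = {A, B} - {{}}" for W' W''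
  proof -
    have dAB: "A \<inter> B = {}" by (auto simp: A_def B_def defs)
    have *: "W' = A \<and> W'' = B \<or> W' = B \<and> W'' = A"
    proof -
      have "W' = {} \<or> W' = A \<or> W' = B" "W'' = {} \<or> W'' = A \<or> W'' = B" using W(2) by blast+
      moreover have "A = {} \<or> A = W' \<or> A = W''" "B = {} \<or> B = W' \<or> B = W''" using W(2) by blast+
      ultimately show ?thesis using W(1) dAB by (metis Int_absorb)
    qed
    have un: "W_less G u v \<union> A = H" "W_less G v u \<union> B = H'" "W_less G u v \<union> B = K'" "W_less G v u \<union> A = K"
      unfolding Weq by (auto simp: A_def B_def defs)
    have "complementary_halfspaces G H H'" "complementary_halfspaces G K' K"
      using conv unfolding complementary_halfspaces_def by (auto simp: defs)
    then show ?thesis using * un by auto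
  qed
  ultimately show "finite (components ?I) \<and> card (components ?I) \<le> 2 \<and>
      (\<forall>W' W''. W' \<inter> W'' = {} \<and> {W', W''} - {{}} = components ?I \<longrightarrow>
         complementary_halfspaces G (W_less G u v \<union> W') (W_less G v u \<union> W'') \<and>
         complementary_halfspaces G (W_less G u v \<union> W'') (W_less G v u \<union> W'))"
    using card_mono[of "{A, B}" "{A, B} - {{}}"] card_insert_le_m1[of 2 "{B}" A] by auto
qed

text \<open>The label of an edge is the symmetric difference of the images of its ends. An upward
  edge leads away from \<open>b\<close>, so it removes an element of \<open>f b\<close> and adds one
  that is not in \<open>f b\<close>. In a bracket, the removed element of one edge can thus
  meet only the removed element of the other, and likewise for the added ones: all contributions
  are positive.\<close>

lemma embedded_labelling:
  assumes b: "b \<in> V"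
  shows "atom_labelling b (f b) (\<lambda>e. \<Union>x\<in>e. \<Union>y\<in>e. f x - f y)"
proof -
  define l where "l = (\<lambda>e. \<Union>x\<in>e. \<Union>y\<in>e. f x - f y)"
  have lab: "\<exists>i j. i \<in> f b \<and> j \<notin> f b \<and> l {u, v} = {i, j} \<and> f u - f v = {i} \<and> f v - f u = {j} \<and>
      (\<forall>x\<in>V. slope u v x = of_bool (j \<in> f x) - of_bool (i \<in> f x))" if up: "up b u v" for u v
  proof -
    obtain i j where ij: "f u - f v = {i}" "f v - f u = {j}"
      and sl: "\<And>x. x \<in> V \<Longrightarrow> slope u v x = of_bool (j \<in> f x) - of_bool (i \<in> f x)"
      using edge_swap[OF upD(1)[OF up]] by metis
    have "l {u, v} = {i, j}" using ij by (auto simp: l_def)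
    moreover have "i \<in> f b" "j \<notin> f b"
      using sl[OF b] slope_base[OF up] by (auto simp: of_bool_def split: if_splits)
    ultimately show ?thesis using ij sl by (intro exI[of _ i] exI[of _ j]) simp
  qed
  have "\<exists>x\<in>f b. \<exists>y. y \<notin> f b \<and> l e = {x, y}" if "e \<in> vertical_edges G b" for e
    using that lab unfolding vertical_iff_up[OF b] by blast
  moreover have "edge_bracket G u v u' v' = int (card (l {u, v} \<inter> l {u', v'}))"
    if up: "up b u v" "up b u' v'" for u v u' v'
  proof -
    obtain i j where ij: "i \<in> f b" "j \<notin> f b" "l {u, v} = {i, j}"
      and sl: "\<forall>x\<in>V. slope u v x = of_bool (j \<in> f x) - of_bool (i \<in> f x)"
      using lab[OF up(1)] by metis
    obtain i' j' where ij': "i' \<in> f b" "j' \<notin> f b" "l {u', v'} = {i', j'}"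
      and f': "f u' - f v' = {i'}" "f v' - f u' = {j'}"
      using lab[OF up(2)] by metis
    have V': "u' \<in> V" "v' \<in> V" using upD[OF up(2)] by auto
    have mem: "k \<in> f v' \<longleftrightarrow> k = j' \<or> (k \<in> f u' \<and> k \<noteq> i')" for k using f' by blast
    have "i' \<in> f u'" "j' \<notin> f u'" using f' by auto
    then have "edge_bracket G u v u' v' = of_bool (i = i') + of_bool (j = j')"
      unfolding bracket_slope[OF upD(1)[OF up(1)] upD(1)[OF up(2)]]
      using sl V' mem[of i] mem[of j] ij ij' by auto
    then show ?thesis using two_set_Int_card[OF ij(1,2) ij'(1,2)] ij(3) ij'(3) by simp
  qed
  ultimately show ?thesis unfolding atom_labelling_def l_def[symmetric] by blast
qed

end

lemma embeddable_imp_WC_AGC: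
  fixes G :: "'a sgraph"
  assumes "simple_graph G" "connected_graph G" "johnson_embeddable G"
  shows "wallspace_condition G" "b \<in> vertices G \<Longrightarrow> atom_graph_condition G b"
proof -
  obtain m and \<Lambda> :: "('a \<times> nat) set" and f where f: "f ` vertices G \<subseteq> vertices (johnson_graph m \<Lambda>)"
    and dist: "\<And>u v. u \<in> vertices G \<Longrightarrow> v \<in> vertices G \<Longrightarrow>
                 gdist (johnson_graph m \<Lambda>) (f u) (f v) = gdist G u v"
    using assms(3) unfolding johnson_embeddable_def isometrically_embeddable_def
    by (elim exE conjE) simp
  have fv: "f v \<in> vertices (johnson_graph m \<Lambda>)" if "v \<in> vertices G" for v using f that by auto
  interpret johnson_embedded_graph G f m
  proof
    fix u v assume uv: "u \<in> vertices G" "v \<in> vertices G"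
    show "gdist G u v = card (f u - f v)"
      using dist[OF uv] gdist_johnson[OF fv[OF uv(1)] fv[OF uv(2)]] by simp
  qed (use assms fv in \<open>auto simp: johnson_vertices\<close>)
  show "wallspace_condition G" by (rule embedded_WC)
  show "atom_graph_condition G b" if "b \<in> vertices G"
    using labelling_imp_AGC[OF that embedded_labelling[OF that] fin[OF that]] .
qed

lemma WC_AGC_imp_embeddable:
  assumes "simple_graph G" "connected_graph G" "wallspace_condition G"
    and b: "b \<in> vertices G" and "atom_graph_condition G b"
  shows "johnson_embeddable G"
proof -
  interpret metric_graph G by unfold_locales (fact assms)+
  show ?thesis
    using AGC_imp_labelling[OF b assms(3,5)] labelling_imp_embeddable[OF b] by blast
qed

theorem theorem1:
  fixes G :: "'a sgraph"
  assumes "simple_graph G" and "connected_graph G"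
  shows "(johnson_embeddable G \<longleftrightarrow>
            wallspace_condition G \<and> (\<exists>b\<in>vertices G. atom_graph_condition G b)) \<and>
         (johnson_embeddable G \<longleftrightarrow>
            wallspace_condition G \<and> (\<forall>b\<in>vertices G. atom_graph_condition G b))"
proof -
  have "vertices G \<noteq> {}" using assms(2) by (simp add: connected_graph_def)
  then show ?thesis
    using embeddable_imp_WC_AGC[OF assms] WC_AGC_imp_embeddable[OF assms] by blast
qed

end
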